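(* Let $\Gamma$ be an elliptic graph with NN-elliptic sequence of length $m+1$, associated cycles $C_{-1},\dots,C_m$, and minimally elliptic cycle $C$. Then $$P_0(\mathbf t_{|C|})=\sum_{j=-1}^{m-1}\mathbf t_{|C|}^{Z_K-E-C_j},$$ where $\mathbf t_{|C|}$ indicates the substitution $t_v=1$ for all $v\notin|C|$.
   Context: Let $\Gamma$ be a finite connected tree with vertex set $\mathcal V$, each vertex $v$ decorated by an integer $e_v$ (genera zero). $L=\mathbb Z\langle E_v\rangle_{v\in\mathcal V}$ with symmetric form $(E_v,E_v)=e_v$, $(E_v,E_w)=1$ for adjacent $v\ne w$, $0$ otherwise, assumed negative definite; $L'=\{l'\in L\otimes\mathbb Q:(l',L)\subset\mathbb Z\}$, $[l']$ the class in $L'/L$; $E_v^*$ with $(E_v^*,E_w)=-\delta_{vw}$; $\delta_v$ valency; $E=\sum E_v$; $\ge$ coordinatewise, $\prec$ strict in every coordinate, $l>0$ if $l\ge0,l\neq0$; $|l'|=\{v:l'_v\ne0\}$. $Z_K\in L'$ with $(Z_K,E_v)=e_v+2$; $\chi(l')=-(l',l'-Z_K)/2$. $\mathcal S'=\{l':(l',E_v)\le0\ \forall v\}$, $s_h=\min\{l'\in\mathcal S':[l']=h\}$; $Z_{min}(B)$ the minimal nonzero element of $\mathcal S'(B)\cap L(B)$ for a connected full subgraph $B$. $Z(\mathbf t)=\sum z(l')\mathbf t^{l'}$ is the Taylor expansion at $0$ of $\prod_v(1-\mathbf t^{E_v^*})^{\delta_v-2}$ ($\mathbf t^{l'}=\prod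 t_v^{l'_v}$). Canonical polynomial: $P_0(\mathbf t)=\sum_{\ell\in L,\ell\not\prec0}z(Z_K-E-\ell)\mathbf t^\ell$. Elliptic graph: $e_v\le-2$ for all $v$ and $\min_{l\in L,l>0}\chi(l)=0$. Minimally elliptic cycle: the unique $C\in L$, $C>0$, with $\chi(C)=0$ and $\chi(l)>0$ for $0<l<C$. NN-elliptic sequence: $B_{-1}=\Gamma$, $Z_{B_{-1}}=s_{[Z_K]}$, $B_0=|Z_K-s_{[Z_K]}|$; for $j\ge0$, $Z_{B_j}=Z_{min}(B_j)$, and if $Z_K-\sum_{i=-1}^jZ_{B_i}\ne0$, $B_{j+1}=|Z_K-\sum_{i=-1}^jZ_{B_i}|$; $m$ is the index with $Z_K=\sum_{i=-1}^mZ_{B_i}$. $C_j=\sum_{i=-1}^jZ_{B_i}$. *)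

theory Defs
  imports Complex_Main "HOL-Library.Function_Algebras"
begin

text \<open>Plumbing graphs: vertices are the elements of a finite type 'v; the graph is given by
  an adjacency relation adj and integer decorations e.  Elements of L (x) Q are functions
  'v => rat (coordinates in the basis E_v); L is the set of integer-valued ones.
  The ordering on 'v => rat is the pointwise (coordinatewise) one.\<close>

definition is_tree :: "('v::finite \<Rightarrow> 'v \<Rightarrow> bool) \<Rightarrow> bool" where
  "is_tree adj \<longleftrightarrow> (\<forall>v w. adj v w \<longrightarrow> adj w v) \<and> (\<forall>v. \<not> adj v v)
     \<and> (\<forall>v w. adj\<^sup>*\<^sup>* v w)
     \<and> card {{v, w} | v w. adj v w} = card (UNIV :: 'v set) - 1"

definition valency :: "('v::finite \<Rightarrow> 'v \<Rightarrow> bool) \<Rightarrow> 'v \<Rightarrow> nat" where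
  "valency adj v = card {w. adj v w}"

definition basisE :: "'v \<Rightarrow> 'v \<Rightarrow> rat" where
  "basisE v = (\<lambda>w. if w = v then 1 else 0)"

definition inL :: "('v \<Rightarrow> rat) \<Rightarrow> bool" where
  "inL x \<longleftrightarrow> (\<forall>v. x v \<in> \<int>)"

definition supp :: "('v \<Rightarrow> rat) \<Rightarrow> 'v set" where
  "supp x = {v. x v \<noteq> 0}"

definition restr :: "'v set \<Rightarrow> ('v \<Rightarrow> rat) \<Rightarrow> 'v \<Rightarrow> rat" where
  "restr S x = (\<lambda>v. if v \<in> S then x v else 0)"

context
  fixes e :: "'v::finite \<Rightarrow> int" and adj :: "'v \<Rightarrow> 'v \<Rightarrow> bool"
begin

definition imat :: "'v \<Rightarrow> 'v \<Rightarrow> rat" where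
  "imat v w = (if v = w then of_int (e v) else if adj v w then 1 else 0)"

definition form :: "('v \<Rightarrow> rat) \<Rightarrow> ('v \<Rightarrow> rat) \<Rightarrow> rat" where
  "form x y = (\<Sum>v\<in>UNIV. \<Sum>w\<in>UNIV. x v * y w * imat v w)"

definition neg_definite :: bool where
  "neg_definite \<longleftrightarrow> (\<forall>x. x \<noteq> 0 \<longrightarrow> form x x < 0)"

definition inLprime :: "('v \<Rightarrow> rat) \<Rightarrow> bool" where
  "inLprime x \<longleftrightarrow> (\<forall>w. form x (basisE w) \<in> \<int>)"

definition Estar :: "'v \<Rightarrow> 'v \<Rightarrow> rat" where
  "Estar v = (THE x. \<forall>w. form x (basisE w) = (if w = v then -1 else 0))"

definition ZK :: "'v \<Rightarrow> rat" where
  "ZK = (THE x. \<forall>w. form x (basisE w) = of_int (e w) + 2)"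

definition chi :: "('v \<Rightarrow> rat) \<Rightarrow> rat" where
  "chi x = - form x (x - ZK) / 2"

definition Sprime :: "('v \<Rightarrow> rat) set" where
  "Sprime = {x. inLprime x \<and> (\<forall>v. form x (basisE v) \<le> 0)}"

definition sZK :: "'v \<Rightarrow> rat" where
  "sZK = (THE x. x \<in> Sprime \<and> inL (x - ZK) \<and>
                 (\<forall>y. y \<in> Sprime \<and> inL (y - ZK) \<longrightarrow> x \<le> y))"

text \<open>S'(B) \<inter> L(B) without zero, for a (full) subgraph with vertex set B.\<close>
definition ZminSet :: "'v set \<Rightarrow> ('v \<Rightarrow> rat) set" where
  "ZminSet B = {x. inL x \<and> supp x \<subseteq> B \<and> x \<noteq> 0 \<and> (\<forall>v\<in>B. form x (basisE v) \<le> 0)}"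

definition Zmin :: "'v set \<Rightarrow> 'v \<Rightarrow> rat" where
  "Zmin B = (THE x. x \<in> ZminSet B \<and> (\<forall>y\<in>ZminSet B. x \<le> y))"

text \<open>NN-elliptic sequence, shifted by one: Cseq n = C_{n-1} in the paper's indexing,
  i.e. Cseq 0 = C_{-1} = s_{[Z_K]}, Cseq (n+1) = C_n = C_{n-1} + Z_min(B_n) with
  B_n = |Z_K - C_{n-1}|.\<close>
primrec Cseq :: "nat \<Rightarrow> 'v \<Rightarrow> rat" where
  "Cseq 0 = sZK"
| "Cseq (Suc n) = Cseq n + Zmin (supp (ZK - Cseq n))"

definition elliptic :: bool where
  "elliptic \<longleftrightarrow> (\<forall>v. e v \<le> -2)
     \<and> (\<forall>l. inL l \<and> l \<ge> 0 \<and> l \<noteq> 0 \<longrightarrow> chi l \<ge> 0)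
     \<and> (\<exists>l. inL l \<and> l \<ge> 0 \<and> l \<noteq> 0 \<and> chi l = 0)"

definition min_elliptic_cycle :: "('v \<Rightarrow> rat) \<Rightarrow> bool" where
  "min_elliptic_cycle C \<longleftrightarrow> inL C \<and> C \<ge> 0 \<and> C \<noteq> 0 \<and> chi C = 0
     \<and> (\<forall>l. inL l \<and> l \<ge> 0 \<and> l \<noteq> 0 \<and> l \<le> C \<and> l \<noteq> C \<longrightarrow> chi l > 0)"

text \<open>Coefficient of x^k in (1 - x)^n, n an integer (binomial series).\<close>
definition bincoef :: "int \<Rightarrow> nat \<Rightarrow> rat" where
  "bincoef n k = (-1::rat) ^ k * (rat_of_int n gchoose k)"

text \<open>z(l'): coefficient of t^{l'} in the expansion of prod_v (1 - t^{E_v^*})^{delta_v - 2}.\<close>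
definition zcoef :: "('v \<Rightarrow> rat) \<Rightarrow> rat" where
  "zcoef x = (\<Sum>k\<in>{k :: 'v \<Rightarrow> nat. (\<lambda>w. \<Sum>v\<in>UNIV. of_nat (k v) * Estar v w) = x}.
                 \<Prod>v\<in>UNIV. bincoef (int (valency adj v) - 2) (k v))"

definition EE :: "'v \<Rightarrow> rat" where
  "EE = (\<lambda>v. 1)"

text \<open>Coefficients of the canonical polynomial P_0: the monomial t^l (l in L, l not < 0
  in every coordinate) has coefficient z(Z_K - E - l).\<close>
definition P0_support :: "('v \<Rightarrow> rat) set" where
  "P0_support = {l. inL l \<and> (\<exists>v. l v \<ge> 0) \<and> zcoef (ZK - EE - l) \<noteq> 0}"

text \<open>Coefficient of t^a in P_0(t_S), the substitution t_v = 1 for v not in S.\<close>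
definition P0_subst_coeff :: "'v set \<Rightarrow> ('v \<Rightarrow> rat) \<Rightarrow> rat" where
  "P0_subst_coeff S a = (\<Sum>l\<in>{l\<in>P0_support. restr S l = a}. zcoef (ZK - EE - l))"

end

end

theory Submission
  imports Defs "HOL-Analysis.Cartesian_Space"
begin

text \<open>Write the exponents as \<open>Z\<^sub>K + y\<close> with \<open>y\<close> integral, so that the coefficient is a product over the vertices
  of binomial coefficients in \<open>- (Z\<^sub>K + y, E\<^sub>v)\<close>; it vanishes unless \<open>Z\<^sub>K + y\<close> lies in \<open>S'\<close>, and only
  \<open>y\<close> without \<open>y \<ge> 0\<close> occur in the canonical polynomial. For such \<open>y\<close> the cycle \<open>l = - min(y, 0)\<close> satisfies
  \<open>\<chi>(l) \<le> 0\<close>, so ellipticity forces \<open>\<chi>(l) = 0\<close>, hence \<open>l \<ge> C\<close>, and \<open>Z\<^sub>K + y\<close> is orthogonal to \<open>E\<^sub>v\<close> for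
  \<open>v\<close> in \<open>|C|\<close>. The elements \<open>Z\<^sub>K - l\<close> of \<open>S'\<close> with \<open>l > 0\<close> are exactly the cycles of the elliptic sequence
  before \<open>Z\<^sub>K\<close>, and they are separated by their coordinates on \<open>|C|\<close>.

  It remains to see that the coefficients with a prescribed restriction to \<open>|C|\<close> sum to \<open>1\<close>. The complement
  of \<open>|C|\<close> is removed leaf by leaf: summing over the coordinate of a leaf \<open>v\<close> attached to \<open>u\<close> multiplies the factor
  \<open>(1 - t)\<^bsup>\<delta>-2\<^esup>\<close> of \<open>u\<close> by \<open>1 / (1 - t)\<close>, that is, yields the factor of \<open>u\<close> in the smaller tree, as long as the
  admissible coordinates at \<open>v\<close> form an upward closed set. This holds because cycles outside \<open>|C|\<close> together with
  one neighbouring vertex still have \<open>\<chi> \<ge> 1\<close>. What is left on \<open>|C|\<close> is a product of binomial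
  coefficients at \<open>0\<close>.\<close>

section \<open>Lattice and graph preliminaries\<close>

definition bincoef_ext :: "int \<Rightarrow> int \<Rightarrow> rat" where
  "bincoef_ext p k = (if k < 0 then 0 else bincoef p (nat k))"

lemma bincoef_ext_neg [simp]: "k < 0 \<Longrightarrow> bincoef_ext p k = 0"
  by (simp add: bincoef_ext_def)

lemma bincoef_ext_zero [simp]: "bincoef_ext p 0 = 1"
  by (simp add: bincoef_ext_def bincoef_def)

text \<open>The exponent -1 is valency minus 2 at a leaf; the geometric series turns that factor
  into an indicator function.\<close>

lemma bincoef_ext_minus_one: "bincoef_ext (-1) k = (if k < 0 then 0 else 1)"
proof -
  have "(-1::rat) ^ n * (- 1 gchoose n) = 1" for n :: nat
    using gbinomial_minus[of "1::rat" n] binomial_gbinomial[of n n, where 'a=rat]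
    by (simp flip: power_add mult.assoc)
  then show ?thesis by (simp add: bincoef_ext_def bincoef_def)
qed

text \<open>Multiplication by 1/(1 - x) replaces coefficients by partial sums. The index set
  \<open>N\<close> may exceed the window \<open>{m..K}\<close>, since terms outside it
  vanish.\<close>

lemma bincoef_ext_partial_sum:
  assumes "finite N" and "{m..K} \<subseteq> N"
  shows "(\<Sum>n\<in>N. if m \<le> n then bincoef_ext p (K - n) else 0) = bincoef_ext (p - 1) (K - m)"
proof -
  have "(\<Sum>n\<in>N. if m \<le> n then bincoef_ext p (K - n) else 0) = (\<Sum>n\<in>{m..K}. bincoef_ext p (K - n))"
    by (rule sum.mono_neutral_cong_right) (use assms in auto)
  also have "\<dots> = bincoef_ext (p - 1) (K - m)"
  proof (cases "K < m")
    case True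
    then show ?thesis by simp
  next
    case False
    have "(\<Sum>n\<in>{m..K}. bincoef_ext p (K - n)) = (\<Sum>j\<le>nat (K - m). bincoef p j)"
      by (rule sum.reindex_bij_witness[where i = "\<lambda>j. K - int j" and j = "\<lambda>n. nat (K - n)"])
        (use False in \<open>auto simp: bincoef_ext_def\<close>)
    also have "\<dots> = bincoef (p - 1) (nat (K - m))"
      using gbinomial_sum_lower_neg[of "rat_of_int p" "nat (K - m)"]
      by (simp add: bincoef_def mult.commute)
    finally show ?thesis using False by (simp add: bincoef_ext_def)
  qed
  finally show ?thesis .
qed

section \<open>The intersection form on integer vectors\<close>

definition unitv :: "'v \<Rightarrow> 'v \<Rightarrow> int" where
  "unitv u = (\<lambda>w. if w = u then 1 else 0)"

locale graph_lattice =
  fixes e :: "'v::finite \<Rightarrow> int" and adj :: "'v \<Rightarrow> 'v \<Rightarrow> bool"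
  assumes adj_sym: "adj v w \<Longrightarrow> adj w v"
    and adj_irrefl: "\<not> adj v v"
begin

text \<open>With \<open>D = UNIV\<close> this is the intersection number with E_a; a smaller
  \<open>D\<close> drops the edges from \<open>a\<close> that leave a branch.\<close>

definition dot :: "'v set \<Rightarrow> ('v \<Rightarrow> int) \<Rightarrow> 'v \<Rightarrow> int" where
  "dot D x a = e a * x a + (\<Sum>b | b \<in> D \<and> adj a b. x b)"

definition pair :: "('v \<Rightarrow> int) \<Rightarrow> ('v \<Rightarrow> int) \<Rightarrow> int" where
  "pair x y = (\<Sum>a\<in>UNIV. x a * dot UNIV y a)"

text \<open>\<open>chi2\<close> is twice \<open>\<chi>\<close>, and \<open>dualcoef UNIV y a\<close> is the coefficient of \<open>E\<^sub>a\<^sup>*\<close> in \<open>Z\<^sub>K + y\<close>.\<close>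

definition chi2 :: "('v \<Rightarrow> int) \<Rightarrow> int" where
  "chi2 x = (\<Sum>a\<in>UNIV. x a * (e a + 2 - dot UNIV x a))"

definition dualcoef :: "'v set \<Rightarrow> ('v \<Rightarrow> int) \<Rightarrow> 'v \<Rightarrow> int" where
  "dualcoef D y a = - (e a + 2) - dot D y a"

text \<open>Says that Z_K + y lies in S'; \<open>y\<close> is the integral displacement from
  Z_K.\<close>

definition nef :: "('v \<Rightarrow> int) \<Rightarrow> bool" where
  "nef y \<longleftrightarrow> (\<forall>a. 0 \<le> dualcoef UNIV y a)"

lemma dot_add: "dot D (x + y) a = dot D x a + dot D y a"
  by (simp add: dot_def sum.distrib algebra_simps)

lemma dot_diff: "dot D (x - y) a = dot D x a - dot D y a"
  by (simp add: dot_def sum_subtractf algebra_simps)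

lemma dot_minus: "dot D (- x) a = - dot D x a"
  by (simp add: dot_def sum_negf)

lemma dot_scale: "dot D (\<lambda>v. c * x v) a = c * dot D x a"
  by (simp add: dot_def sum_distrib_left algebra_simps)

lemma dot_sum: "dot D (\<lambda>v. \<Sum>i\<in>I. f i v) a = (\<Sum>i\<in>I. dot D (f i) a)"
  unfolding dot_def sum.distrib sum_distrib_left
  by (subst sum.swap) simp

text \<open>With the coordinate at \<open>a\<close> fixed only the off-diagonal entries matter, and
  these are nonnegative.\<close>

lemma dot_mono: "x \<le> y \<Longrightarrow> x a = y a \<Longrightarrow> dot D x a \<le> dot D y a"
  unfolding dot_def by (intro add_mono sum_mono) (auto simp: le_fun_def)

lemma dot_mono_set: "D \<subseteq> D' \<Longrightarrow> 0 \<le> x \<Longrightarrow> dot D x a \<le> dot D' x a"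
  unfolding dot_def by (intro add_mono sum_mono2) (auto simp: le_fun_def)

lemma dot_cong: "x a = y a \<Longrightarrow> (\<And>b. b \<in> D \<Longrightarrow> adj a b \<Longrightarrow> x b = y b) \<Longrightarrow> dot D x a = dot D y a"
  unfolding dot_def by (auto intro!: sum.cong)

lemma dualcoef_mono: "x \<le> y \<Longrightarrow> x a = y a \<Longrightarrow> dualcoef D y a \<le> dualcoef D x a"
  using dot_mono[of x y a D] by (simp add: dualcoef_def)

lemma dualcoef_add: "dualcoef D (x + y) a = dualcoef D x a - dot D y a"
  by (simp add: dualcoef_def dot_add)

lemma dualcoef_cong: "x a = y a \<Longrightarrow> (\<And>b. b \<in> D \<Longrightarrow> adj a b \<Longrightarrow> x b = y b) \<Longrightarrow> dualcoef D x a = dualcoef D y a"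
  unfolding dualcoef_def using dot_cong[of x a y D] by simp

lemma pair_eq: "pair x y = (\<Sum>a\<in>UNIV. e a * x a * y a) + (\<Sum>a\<in>UNIV. \<Sum>b\<in>UNIV. if adj a b then x a * y b else 0)"
proof -
  have "(\<Sum>b | adj a b. y b) = (\<Sum>b\<in>UNIV. if adj a b then y b else 0)" for a
    by (simp add: sum.If_cases)
  then show ?thesis
    unfolding pair_def dot_def
    by (simp add: algebra_simps sum.distrib sum_distrib_left) (auto intro!: sum.cong)
qed

lemma pair_commute: "pair x y = pair y x"
proof -
  have *: "adj a b = adj b a" for a b using adj_sym by blast
  have "(\<Sum>a\<in>UNIV. \<Sum>b\<in>UNIV. if adj a b then x a * y b else 0)
      = (\<Sum>a\<in>UNIV. \<Sum>b\<in>UNIV. if adj a b then y a * x b else 0)"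
    by (subst sum.swap) (intro sum.cong refl, use * in \<open>simp add: mult.commute\<close>)
  then show ?thesis unfolding pair_eq by (simp add: algebra_simps)
qed

lemma pair_add_right: "pair x (y + z) = pair x y + pair x z"
  by (simp add: pair_def dot_add algebra_simps sum.distrib)

lemma pair_add_left: "pair (x + y) z = pair x z + pair y z"
  by (simp add: pair_def algebra_simps sum.distrib)

lemma pair_unitv: "pair x (unitv u) = dot UNIV x u"
proof -
  have "pair (unitv u) x = (\<Sum>a\<in>UNIV. if a = u then dot UNIV x a else 0)"
    unfolding pair_def unitv_def by (rule sum.cong) auto
  then show ?thesis by (simp add: pair_commute)
qed

lemma chi2_add: "chi2 (x + y) = chi2 x + chi2 y - 2 * pair x y"
proof -
  have "chi2 (x + y) = chi2 x + chi2 y - pair x y - pair y x"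
    by (simp add: chi2_def pair_def dot_add algebra_simps sum.distrib sum_subtractf)
  then show ?thesis using pair_commute[of y x] by simp
qed

lemma chi2_unitv: "chi2 (unitv u) = 2"
proof -
  have "chi2 (unitv u) = (\<Sum>a\<in>UNIV. if a = u then e a + 2 - dot UNIV (unitv u) a else 0)"
    unfolding chi2_def by (rule sum.cong) (auto simp: unitv_def)
  moreover have "dot UNIV (unitv u) u = e u"
    using adj_irrefl by (auto simp: dot_def unitv_def intro!: sum.neutral)
  ultimately show ?thesis by simp
qed

lemma chi2_add_unitv: "chi2 (x + unitv u) = chi2 x + 2 - 2 * dot UNIV x u"
  by (simp add: chi2_add pair_unitv chi2_unitv)

lemma chi2_0 [simp]: "chi2 0 = 0"
  by (simp add: chi2_def)

lemma pair_disjoint_nonneg: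
  assumes "0 \<le> x" "0 \<le> y" "\<And>a. x a * y a = 0"
  shows "0 \<le> pair x y"
proof -
  have "(\<Sum>a\<in>UNIV. e a * x a * y a) = 0"
    by (rule sum.neutral) (use assms(3) in \<open>simp add: mult.assoc\<close>)
  then show ?thesis
    unfolding pair_eq using assms(1,2)
    by (auto simp: le_fun_def intro!: sum_nonneg)
qed

text \<open>The excesses \<open>p\<close> and \<open>q\<close> over the minimum have disjoint
  supports, and the two sides differ by \<open>2 * pair p q\<close>.\<close>

lemma chi2_submodular:
  "chi2 (\<lambda>v. min (x v) (y v)) + chi2 (\<lambda>v. max (x v) (y v)) \<le> chi2 x + chi2 y"
proof -
  define m where "m = (\<lambda>v. min (x v) (y v))"
  define p where "p = x - m"
  define q where "q = y - m"
  have xy: "x = m + p" "y = m + q" by (simp_all add: p_def q_def)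
  have M: "(\<lambda>v. max (x v) (y v)) = m + p + q"
    by (auto simp: m_def p_def q_def max_def min_def)
  have "0 \<le> pair p q"
    by (rule pair_disjoint_nonneg) (auto simp: p_def q_def m_def le_fun_def min_def)
  then show ?thesis
    unfolding M m_def[symmetric] by (simp add: xy chi2_add pair_add_left)
qed

end

text \<open>\<open>dual_exists\<close> provides a positive integral multiple of
  \<open>Estar\<close>, which keeps the arguments over the integers.\<close>

locale neg_def_tree = graph_lattice +
  assumes neg_def: "x \<noteq> 0 \<Longrightarrow> pair x x < 0"
    and connected: "adj\<^sup>*\<^sup>* v w"
    and card_edges: "card {{v, w} | v w. adj v w} = card (UNIV :: 'a set) - 1"
    and e_le: "e v \<le> -2"
    and dual_exists: "\<exists>p. (\<forall>w. w \<noteq> v \<longrightarrow> dot UNIV p w = 0) \<and> dot UNIV p v < 0"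
begin

text \<open>For the negative part \<open>n\<close> the hypothesis gives
  \<open>pair n x \<le> 0\<close>, while its disjointness from the positive part gives
  \<open>pair n x \<ge> - pair n n\<close>; negative definiteness leaves
  \<open>n = 0\<close>.\<close>

lemma nonneg_of_dot_nonpos:
  assumes "\<And>a. x a < 0 \<Longrightarrow> dot UNIV x a \<le> 0"
  shows "0 \<le> x"
proof -
  define n where "n = (\<lambda>a. max 0 (- x a))"
  define p where "p = x + n"
  have "pair n x \<le> 0"
    unfolding pair_def
  proof (rule sum_nonpos)
    show "n a * dot UNIV x a \<le> 0" for a
      using assms[of a] by (cases "x a < 0") (auto simp: n_def max_def mult_nonpos_nonpos)
  qed
  moreover have "pair n x = pair n p - pair n n"
    by (simp add: p_def pair_add_right)
  moreover have "0 \<le> pair n p"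
    by (rule pair_disjoint_nonneg) (auto simp: n_def p_def max_def le_fun_def)
  ultimately have "n = 0" using neg_def[of n] by fastforce
  then have "max 0 (- x a) = 0" for a unfolding n_def by (metis zero_fun_apply)
  then have "0 \<le> x a" for a by (smt (verit))
  then show ?thesis by (simp add: le_fun_def)
qed

lemma dual_vector:
  obtains p where "\<And>w. w \<noteq> v \<Longrightarrow> dot UNIV p w = 0" "dot UNIV p v < 0" "0 \<le> p" "0 < p v"
proof -
  obtain p where p: "\<And>w. w \<noteq> v \<Longrightarrow> dot UNIV p w = 0" "dot UNIV p v < 0"
    using dual_exists by blast
  have p0: "0 \<le> p"
    by (rule nonneg_of_dot_nonpos) (metis p less_imp_le order_refl)
  have "p \<noteq> 0" using p(2) by (auto simp: dot_def)
  then have "0 > pair p p" by (rule neg_def)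
  also have "pair p p = (\<Sum>a\<in>UNIV. if a = v then p v * dot UNIV p v else 0)"
    unfolding pair_def by (rule sum.cong) (auto simp: p)
  finally have "p v \<noteq> 0" by auto
  then have "0 < p v" using p0 by (auto simp: le_fun_def order_less_le)
  then show ?thesis using p p0 that by blast
qed

text \<open>The sum of the dual vectors of all vertices. It serves to shift nef vectors into the
  positive cone and to bound a search box.\<close>

lemma positive_antinef:
  obtains y where "\<And>a. dot UNIV y a \<le> -1" "\<And>a. 1 \<le> y a"
proof -
  have "\<exists>p. \<forall>v. (\<forall>w. w \<noteq> v \<longrightarrow> dot UNIV (p v) w = 0) \<and> dot UNIV (p v) v < 0 \<and> 0 \<le> p v \<and> 0 < p v v"
    by (rule choice) (metis dual_vector)
  then obtain p where p: "\<And>v w. w \<noteq> v \<Longrightarrow> dot UNIV (p v) w = 0" "\<And>v. dot UNIV (p v) v < 0"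
      "\<And>v. 0 \<le> p v" "\<And>v. 0 < p v v" by blast
  define y where "y = (\<lambda>w. \<Sum>v\<in>UNIV. p v w)"
  show ?thesis
  proof (rule that[of y])
    show "dot UNIV y a \<le> -1" for a
    proof -
      have "dot UNIV y a = (\<Sum>v\<in>UNIV. if v = a then dot UNIV (p a) a else 0)"
        unfolding y_def dot_sum by (rule sum.cong) (auto simp: p)
      then show ?thesis using p(2)[of a] by simp
    qed
    have "p a a \<le> y a" for a
      unfolding y_def by (rule member_le_sum) (use p(3) in \<open>auto simp: le_fun_def\<close>)
    then show "1 \<le> y a" for a using p(4)[of a] by (smt (verit))
  qed
qed

lemma dualcoef_0: "0 \<le> dualcoef UNIV 0 a"
  using e_le[of a] by (simp add: dualcoef_def dot_def)

text \<open>At each vertex compare with the argument attaining the minimum there: only neighbouring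
  coordinates drop, which raises \<open>dualcoef\<close>.\<close>

lemma nef_min:
  assumes "nef x" "nef y"
  shows "nef (\<lambda>v. min (x v) (y v))"
proof -
  have "0 \<le> dualcoef UNIV (\<lambda>v. min (x v) (y v)) a" for a
  proof (cases "x a \<le> y a")
    case True
    then have "dualcoef UNIV x a \<le> dualcoef UNIV (\<lambda>v. min (x v) (y v)) a"
      by (intro dualcoef_mono) (auto simp: le_fun_def)
    then show ?thesis using assms unfolding nef_def by (metis order_trans)
  next
    case False
    then have "dualcoef UNIV y a \<le> dualcoef UNIV (\<lambda>v. min (x v) (y v)) a"
      by (intro dualcoef_mono) (auto simp: le_fun_def)
    then show ?thesis using assms unfolding nef_def by (metis order_trans)
  qed
  then show ?thesis by (simp add: nef_def)
qed

lemma nef_0: "nef 0"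
  using dualcoef_0 by (simp add: nef_def)

section \<open>Edge counts in subtrees\<close>

definition ecard :: "'a set \<Rightarrow> nat" where
  "ecard T = card {{v, w} | v w. v \<in> T \<and> w \<in> T \<and> adj v w}"

text \<open>Connectedness through cuts, which yields at once the edge along which a vertex set is
  enlarged.\<close>

definition conn :: "'a set \<Rightarrow> bool" where
  "conn T \<longleftrightarrow> (\<forall>A. A \<subseteq> T \<and> A \<noteq> {} \<and> A \<noteq> T \<longrightarrow> (\<exists>u\<in>A. \<exists>v\<in>T - A. adj u v))"

lemma conn_UNIV: "conn UNIV"
  unfolding conn_def
proof (intro allI impI)
  fix A :: "'a set" assume A: "A \<subseteq> UNIV \<and> A \<noteq> {} \<and> A \<noteq> UNIV"
  then obtain a b where ab: "a \<in> A" "b \<notin> A" by blast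
  have "adj\<^sup>*\<^sup>* a b" by (rule connected)
  then have "b \<notin> A \<longrightarrow> (\<exists>u\<in>A. \<exists>v\<in>UNIV - A. adj u v)"
    by (induction rule: rtranclp_induct) (use ab in auto)
  then show "\<exists>u\<in>A. \<exists>v\<in>UNIV - A. adj u v" using ab by blast
qed

lemma conn_insert:
  assumes "conn T" "u \<in> T" "adj u v"
  shows "conn (insert v T)"
  unfolding conn_def
proof (intro allI impI)
  fix A assume A: "A \<subseteq> insert v T \<and> A \<noteq> {} \<and> A \<noteq> insert v T"
  consider "A \<inter> T = {}" | "T \<subseteq> A" | "A \<inter> T \<noteq> {}" "A \<inter> T \<noteq> T" by blast
  then show "\<exists>u\<in>A. \<exists>w\<in>insert v T - A. adj u w"
  proof cases
    case 1
    then have "A = {v}" "u \<notin> A" using A assms by auto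
    then show ?thesis using assms adj_sym by blast
  next
    case 2
    then have "v \<notin> A" using A by auto
    then show ?thesis using assms 2 by blast
  next
    case 3
    then obtain s t where "s \<in> A \<inter> T" "t \<in> T - A \<inter> T" "adj s t"
      using assms(1) unfolding conn_def by (metis inf.cobounded2)
    then show ?thesis by blast
  qed
qed

lemma ecard_insert:
  assumes "v \<notin> T"
  shows "ecard (insert v T) = ecard T + card {u \<in> T. adj u v}"
proof -
  have eq: "{{x, w} | x w. x \<in> insert v T \<and> w \<in> insert v T \<and> adj x w}
      = {{x, w} | x w. x \<in> T \<and> w \<in> T \<and> adj x w} \<union> (\<lambda>u. {u, v}) ` {u \<in> T. adj u v}" (is "?L = ?A \<union> ?B")
  proof
    show "?L \<subseteq> ?A \<union> ?B"
    proof
      fix z assume "z \<in> ?L"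
      then obtain x w where z: "z = {x, w}" "x \<in> insert v T" "w \<in> insert v T" "adj x w" by blast
      consider "x \<in> T" "w \<in> T" | "x = v" "w \<in> T" | "w = v" "x \<in> T"
        using z adj_irrefl by auto
      then show "z \<in> ?A \<union> ?B"
      proof cases
        case 2
        then have "z = {w, v}" "adj w v" using z adj_sym by auto
        then show ?thesis using 2 by blast
      qed (use z in blast)+
    qed
    show "?A \<union> ?B \<subseteq> ?L" by auto
  qed
  have "finite ?A" by (rule finite_subset[of _ "Pow UNIV"]) auto
  moreover have "?A \<inter> ?B = {}" using assms by (auto simp: doubleton_eq_iff)
  moreover have "card ?B = card {u \<in> T. adj u v}"
    by (rule card_image) (auto simp: inj_on_def doubleton_eq_iff)
  ultimately show ?thesis unfolding ecard_def eq by (simp add: card_Un_disjoint)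
qed

text \<open>\<open>T - A\<close> is absorbed vertex by vertex, and by connectedness each new vertex
  brings at least one new edge.\<close>

lemma ecard_grow:
  assumes "conn T" "A \<subseteq> T" "A \<noteq> {}"
  shows "ecard A + card (T - A) \<le> ecard T"
  using assms(2,3)
proof (induction "card (T - A)" arbitrary: A)
  case 0
  then have "A = T" by auto
  then show ?case by simp
next
  case (Suc n)
  then have "A \<noteq> T" by auto
  then obtain u v where uv: "u \<in> A" "v \<in> T - A" "adj u v"
    using assms(1) Suc.prems unfolding conn_def by blast
  have c: "T - insert v A = (T - A) - {v}" by auto
  have n: "card (T - insert v A) = n" unfolding c using uv Suc.hyps(2) by simp
  then have "ecard (insert v A) + n \<le> ecard T"
    using Suc.hyps(1)[of "insert v A"] uv Suc.prems by simp
  moreover have "ecard (insert v A) = ecard A + card {u \<in> A. adj u v}"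
    using uv by (intro ecard_insert) auto
  moreover have "{u \<in> A. adj u v} \<noteq> {}" using uv by blast
  then have "card {u \<in> A. adj u v} \<noteq> 0" by simp
  ultimately show ?case using Suc.hyps(2) by linarith
qed

text \<open>A second edge from \<open>v\<close> into \<open>T\<close> would close a cycle: a
  connected \<open>T\<close> has at least \<open>card T - 1\<close> edges and each vertex outside
  \<open>insert v T\<close> adds at least one more, so the total would exceed
  \<open>card UNIV - 1\<close>.\<close>

lemma unique_neighbour:
  assumes "conn T" "v \<notin> T" "u \<in> T" "u' \<in> T" "adj u v" "adj u' v"
  shows "u = u'"
proof -
  have "ecard (insert v T) + card (UNIV - insert v T) \<le> ecard UNIV"
    by (rule ecard_grow) (auto simp: conn_UNIV)
  moreover have "ecard UNIV = card (UNIV :: 'a set) - 1"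
    using card_edges by (simp add: ecard_def)
  moreover have "card (UNIV - insert v T) = card (UNIV :: 'a set) - card T - 1"
    using assms(2) by (subst card_Diff_subset) auto
  moreover have "ecard (insert v T) = ecard T + card {u \<in> T. adj u v}"
    by (rule ecard_insert) fact
  moreover have "ecard {u} + card (T - {u}) \<le> ecard T"
    by (rule ecard_grow) (use assms in auto)
  moreover have "card (T - {u}) = card T - 1" using assms by simp
  moreover have "card (insert v T) \<le> card (UNIV :: 'a set)" by (rule card_mono) auto
  then have "card T + 1 \<le> card (UNIV :: 'a set)" using assms by simp
  moreover have "card T \<ge> 1" using assms by (metis One_nat_def Suc_leI card_gt_0_iff empty_iff finite)
  ultimately have "card {u \<in> T. adj u v} \<le> 1" by linarith
  then show ?thesis using assms by (auto simp: card_le_Suc0_iff_eq)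
qed

end

section \<open>Elliptic cycles and the elliptic sequence\<close>

text \<open>Minimise the coordinate sum: the minimum of \<open>m\<close> with an element not above
  it would have a smaller sum. Subtracting \<open>b\<close> keeps the sum nonnegative, so
  \<open>nat\<close> loses nothing.\<close>

lemma least_of_min_closed:
  fixes X :: "('v::finite \<Rightarrow> int) set"
  assumes "X \<noteq> {}" and closed: "\<And>x y. x \<in> X \<Longrightarrow> y \<in> X \<Longrightarrow> (\<lambda>v. min (x v) (y v)) \<in> X"
    and bound: "\<And>x. x \<in> X \<Longrightarrow> b \<le> x"
  shows "\<exists>m\<in>X. \<forall>x\<in>X. m \<le> x"
proof -
  define f where "f x = nat (\<Sum>v\<in>UNIV. x v - b v)" for x :: "'v \<Rightarrow> int"
  obtain m where m: "m \<in> X" "\<And>x. x \<in> X \<Longrightarrow> f m \<le> f x"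
    using assms(1) ex_has_least_nat[of "\<lambda>x. x \<in> X" _ f] by blast
  have "m v \<le> x v" if x: "x \<in> X" for x v
  proof (rule ccontr)
    assume v: "\<not> m v \<le> x v"
    let ?y = "\<lambda>v. min (m v) (x v)"
    have y: "?y \<in> X" using closed m(1) x by blast
    have "(\<Sum>v\<in>UNIV. ?y v - b v) < (\<Sum>v\<in>UNIV. m v - b v)"
      by (rule sum_strict_mono_ex1) (use v in \<open>auto intro!: exI[of _ v]\<close>)
    moreover have "0 \<le> (\<Sum>v\<in>UNIV. ?y v - b v)"
      by (rule sum_nonneg) (use bound[OF y] in \<open>auto simp: le_fun_def\<close>)
    ultimately have "f ?y < f m" by (simp add: f_def)
    then show False using m(2)[OF y] by simp
  qed
  then show ?thesis using m(1) by (auto simp: le_fun_def)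
qed

lemma finite_obtain_max:
  fixes f :: "'b \<Rightarrow> int"
  assumes "finite X" "x0 \<in> X"
  obtains d where "d \<in> X" "\<And>x. x \<in> X \<Longrightarrow> f x \<le> f d"
proof -
  have "Max (f ` X) \<in> f ` X" using assms by (intro Max_in) auto
  then obtain d where "d \<in> X" "f d = Max (f ` X)" by force
  then show ?thesis using assms that by (metis Max_ge finite_imageI imageI)
qed

section \<open>Bounds and finiteness for nef displacements\<close>

context neg_def_tree
begin

text \<open>One translation works for all nef \<open>y\<close>: \<open>R\<close> bounds every
  \<open>dot UNIV y a\<close>, and adding \<open>R\<close> times a vector with intersection numbers
  at most -1 makes them nonpositive.\<close>

lemma nef_translate_nonneg: "\<exists>q. \<forall>y. nef y \<longrightarrow> 0 \<le> y + q \<and> (\<forall>a. dot UNIV (y + q) a \<le> 0)"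
proof -
  obtain p where p: "\<And>a. dot UNIV p a \<le> -1" "\<And>a. 1 \<le> p a"
    using positive_antinef by blast
  define R where "R = (\<Sum>a\<in>UNIV. - (e a + 2))"
  have R: "- (e a + 2) \<le> R" for a
    unfolding R_def
  proof (rule member_le_sum)
    show "0 \<le> - (e x + 2)" for x using e_le[of x] by simp
  qed auto
  have "0 \<le> y + (\<lambda>v. R * p v) \<and> (\<forall>a. dot UNIV (y + (\<lambda>v. R * p v)) a \<le> 0)" if "nef y" for y
  proof -
    have *: "dot UNIV (y + (\<lambda>v. R * p v)) a \<le> 0" for a
    proof -
      have "0 \<le> R" using R[of a] e_le[of a] by linarith
      then have "R * dot UNIV p a \<le> R * (-1)" using p(1) by (intro mult_left_mono) auto
      moreover have "dot UNIV y a \<le> - (e a + 2)" using that by (simp add: nef_def dualcoef_def)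
      ultimately show ?thesis using R[of a] by (simp add: dot_add dot_scale)
    qed
    then show ?thesis using nonneg_of_dot_nonpos by blast
  qed
  then show ?thesis by blast
qed

lemma nef_bounded_below: "\<exists>b. \<forall>y. nef y \<longrightarrow> b \<le> y"
proof -
  obtain q where q: "\<And>y. nef y \<Longrightarrow> 0 \<le> y + q" using nef_translate_nonneg by blast
  have "- q \<le> y" if "nef y" for y
  proof (rule le_funI)
    fix a
    have "0 \<le> (y + q) a" using q[OF that] by (simp only: le_fun_def zero_fun_apply)
    then show "(- q) a \<le> y a" by simp
  qed
  then show ?thesis by blast
qed

text \<open>A bound travels along a path: antinefness at \<open>a\<close> of the nonnegative vector
  \<open>y + q\<close> bounds each neighbouring coordinate by \<open>- e a\<close> times the
  coordinate at \<open>a\<close>.\<close>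

lemma nef_bounded_above: "\<exists>c. \<forall>y. nef y \<and> y u \<le> t \<longrightarrow> y w \<le> c"
proof -
  obtain q where q: "\<And>y. nef y \<Longrightarrow> 0 \<le> y + q" "\<And>y a. nef y \<Longrightarrow> dot UNIV (y + q) a \<le> 0"
    using nef_translate_nonneg by blast
  have "adj\<^sup>*\<^sup>* u w" by (rule connected)
  then show ?thesis
  proof (induction rule: rtranclp_induct)
    case base
    then show ?case by blast
  next
    case (step a b)
    then obtain c where c: "\<And>y. nef y \<and> y u \<le> t \<Longrightarrow> y a \<le> c" by blast
    have "y b \<le> - e a * (c + q a) - q b" if y: "nef y \<and> y u \<le> t" for y
    proof -
      have nn: "0 \<le> (y + q) v" for v using q(1)[of y] y by (simp only: le_fun_def zero_fun_apply)
      have "(y + q) b \<le> (\<Sum>b | b \<in> UNIV \<and> adj a b. (y + q) b)"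
        by (rule member_le_sum) (use step nn in auto)
      also have "\<dots> \<le> - e a * (y + q) a"
        using q(2)[of y a] y by (simp add: dot_def)
      also have "\<dots> \<le> - e a * (c + q a)"
        using c[OF y] e_le[of a] by (intro mult_left_mono) auto
      finally show ?thesis by simp
    qed
    then show ?case by blast
  qed
qed

lemma finite_nef: "finite {y. nef y \<and> y u \<le> t}"
proof -
  obtain b where b: "\<And>y. nef y \<Longrightarrow> b \<le> y" using nef_bounded_below by blast
  obtain c where c: "\<And>y w. nef y \<and> y u \<le> t \<Longrightarrow> y w \<le> c w"
    using nef_bounded_above[of u t] by metis
  have "{y. nef y \<and> y u \<le> t} \<subseteq> Pi\<^sub>E UNIV (\<lambda>w. {b w..c w})"
    using b c by (auto simp: le_fun_def)
  then show ?thesis by (rule finite_subset) (auto intro: finite_PiE)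
qed

lemma dot_min_nonpos:
  assumes "dot UNIV x a \<le> 0" "dot UNIV y a \<le> 0"
  shows "dot UNIV (\<lambda>v. min (x v) (y v)) a \<le> 0"
proof (cases "x a \<le> y a")
  case True
  then have "dot UNIV (\<lambda>v. min (x v) (y v)) a \<le> dot UNIV x a"
    by (intro dot_mono) (auto simp: le_fun_def)
  then show ?thesis using assms by simp
next
  case False
  then have "dot UNIV (\<lambda>v. min (x v) (y v)) a \<le> dot UNIV y a"
    by (intro dot_mono) (auto simp: le_fun_def)
  then show ?thesis using assms by simp
qed

lemma least_nef_exists: "\<exists>s. nef s \<and> (\<forall>y. nef y \<longrightarrow> s \<le> y)"
proof -
  obtain b where b: "\<And>y. nef y \<Longrightarrow> b \<le> y" using nef_bounded_below by blast
  have "\<exists>m\<in>Collect nef. \<forall>x\<in>Collect nef. m \<le> x"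
    by (rule least_of_min_closed[where b = b]) (use nef_0 nef_min b in auto)
  then show ?thesis by simp
qed

end

section \<open>Elliptic trees and the minimally elliptic cycle\<close>

locale elliptic_tree = neg_def_tree +
  fixes C :: "'a \<Rightarrow> int"
  assumes chi2_nonneg: "0 \<le> l \<Longrightarrow> 0 \<le> chi2 l"
    and C_nonneg: "0 \<le> C" and C_nonzero: "C \<noteq> 0" and chi2_C: "chi2 C = 0"
    and C_minimal: "0 \<le> l \<Longrightarrow> l \<noteq> 0 \<Longrightarrow> l \<le> C \<Longrightarrow> l \<noteq> C \<Longrightarrow> 0 < chi2 l"
begin

text \<open>If \<open>C\<close> and \<open>l\<close> were disjoint, \<open>C\<close> could be extended vertex by vertex along a path towards \<open>l\<close>
  without increasing \<open>\<chi>\<close>; once it is adjacent to \<open>l\<close>, adding \<open>l\<close> makes \<open>\<chi>\<close> negative.\<close>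

lemma C_le:
  assumes "0 \<le> l" "l \<noteq> 0" "chi2 l = 0"
  shows "C \<le> l"
proof -
  let ?m = "\<lambda>v. min (C v) (l v)"
  have m: "0 \<le> ?m" "?m \<le> C" using C_nonneg assms(1) by (auto simp: le_fun_def)
  have "0 \<le> (\<lambda>v. max (C v) (l v))" using C_nonneg by (auto simp: le_fun_def intro: max.coboundedI1)
  \<comment> \<open>Submodularity, with the maximum contributing a nonnegative value. By minimality
    of \<open>C\<close> a nonzero minimum must then be \<open>C\<close> itself.\<close>
  then have chim: "chi2 ?m \<le> 0"
    using chi2_submodular[of C l] chi2_nonneg chi2_C assms(3) by fastforce
  show ?thesis
  proof (cases "?m = 0")
    case False
    then have "?m = C" using C_minimal[OF m(1) False m(2)] chim by force
    then show ?thesis unfolding le_fun_def by (metis min.cobounded2)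
  next
    case True
    then have disj: "C v = 0 \<or> l v = 0" for v
        using fun_cong[OF True, of v] by (auto simp: min_def split: if_splits)
    obtain v0 where v0: "C v0 \<noteq> 0" using C_nonzero by (auto simp: fun_eq_iff)
    obtain w0 where w0: "l w0 \<noteq> 0" using assms(2) by (auto simp: fun_eq_iff)
    have "adj\<^sup>*\<^sup>* v0 w0" by (rule connected)
    then have "\<exists>a. 0 \<le> a \<and> chi2 a = 0 \<and> (\<forall>b. a b = 0 \<or> l b = 0) \<and> a w0 \<noteq> 0"
    proof (induction rule: rtranclp_induct)
      case base
      then show ?case using C_nonneg chi2_C disj v0 by blast
    next
      case (step y z)
      then obtain a where a: "0 \<le> a" "chi2 a = 0" "\<And>b. a b = 0 \<or> l b = 0" "a y \<noteq> 0" by blast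
      have pos: "0 \<le> a b" "0 \<le> l b" for b using a(1) assms(1) by (auto simp: le_fun_def)
      show ?case
      proof (cases "a z = 0")
        case False
        then show ?thesis using a by blast
      next
        case True
        have "adj z y" using step adj_sym by blast
        then have "a y \<le> (\<Sum>b | b \<in> UNIV \<and> adj z b. a b)"
          by (intro member_le_sum) (use pos in auto)
        then have dz: "1 \<le> dot UNIV a z"
          using pos[of y] a(4) True by (simp add: dot_def)
        show ?thesis
        proof (cases "l z = 0")
          case True
          have "chi2 (a + unitv z) \<le> 0" using dz a(2) by (simp add: chi2_add_unitv)
          moreover have nn: "0 \<le> a + unitv z" using pos by (auto simp: le_fun_def unitv_def)
          ultimately have "chi2 (a + unitv z) = 0" using chi2_nonneg[OF nn] by simp
          moreover have "(a + unitv z) b = 0 \<or> l b = 0" for b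
            using a(3)[of b] True by (auto simp: unitv_def)
          moreover have "(a + unitv z) z \<noteq> 0" using \<open>a z = 0\<close> by (simp add: unitv_def)
          ultimately show ?thesis using nn by blast
        next
          case False
          have "l z * dot UNIV a z \<le> pair l a"
            unfolding pair_def
          proof (rule member_le_sum)
            fix b assume "b \<in> UNIV - {z}"
            show "0 \<le> l b * dot UNIV a b"
            proof (cases "l b = 0")
              case False
              then have "a b = 0" using a(3) by blast
              then have "0 \<le> dot UNIV a b" by (auto simp: dot_def pos intro!: sum_nonneg)
              then show ?thesis using pos by simp
            qed simp
          qed auto
          moreover have "0 < l z * dot UNIV a z" using False pos[of z] dz by simp
          moreover have "0 \<le> l + a" using pos by (auto simp: le_fun_def)
          then have "0 \<le> chi2 (l + a)" by (rule chi2_nonneg)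
          ultimately show ?thesis using a(2) assms(3) by (simp add: chi2_add)
        qed
      qed
    qed
    then show ?thesis using w0 by blast
  qed
qed

text \<open>Cutting \<open>C\<close> into \<open>x + y\<close> gives two proper parts with positive
  \<open>chi2\<close>, so \<open>chi2 C = 0\<close> forces \<open>pair x y > 0\<close>, and only an
  edge across the cut can cause that.\<close>

lemma conn_support: "conn {a. C a \<noteq> 0}"
  unfolding conn_def
proof (intro allI impI)
  fix A assume A: "A \<subseteq> {a. C a \<noteq> 0} \<and> A \<noteq> {} \<and> A \<noteq> {a. C a \<noteq> 0}"
  define x where "x = (\<lambda>a. if a \<in> A then C a else 0)"
  define y where "y = (\<lambda>a. if a \<in> A then 0 else C a)"
  have C: "C = x + y" by (auto simp: x_def y_def)
  have nn: "0 \<le> x" "0 \<le> y" "x \<le> C" "y \<le> C"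
    using C_nonneg by (auto simp: le_fun_def x_def y_def)
  obtain a b where "a \<in> A" "C a \<noteq> 0" "b \<notin> A" "C b \<noteq> 0" using A by blast
  then have "x a \<noteq> 0" "y b \<noteq> 0" "y a = 0" "x b = 0" by (auto simp: x_def y_def)
  then have "x \<noteq> 0" "y \<noteq> 0" "x \<noteq> C" "y \<noteq> C" using \<open>C a \<noteq> 0\<close> \<open>C b \<noteq> 0\<close> by auto
  then have "0 < chi2 x" "0 < chi2 y" using nn C_minimal by auto
  then have "0 < pair x y" using chi2_C unfolding C by (simp add: chi2_add)
  then obtain u where u: "0 < x u * dot UNIV y u"
    unfolding pair_def by (meson not_less sum_nonpos)
  then have "x u \<noteq> 0" by auto
  then have "u \<in> A" by (auto simp: x_def split: if_splits)
  moreover have "dot UNIV y u \<noteq> 0" using u by auto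
  then have "(\<Sum>b | b \<in> UNIV \<and> adj u b. y b) \<noteq> 0"
    using \<open>u \<in> A\<close> by (simp add: dot_def y_def)
  then obtain v where "adj u v" "y v \<noteq> 0"
    by (auto elim: sum.not_neutral_contains_not_neutral)
  then have "\<exists>v\<in>{a. C a \<noteq> 0} - A. adj u v"
    by (intro bexI[of _ v]) (auto simp: y_def split: if_splits)
  ultimately show "\<exists>u\<in>A. \<exists>v\<in>{a. C a \<noteq> 0} - A. adj u v" by blast
qed

lemma chi2_uminus: "chi2 (- y) = (\<Sum>a\<in>UNIV. y a * dualcoef UNIV y a)"
  unfolding chi2_def by (rule sum.cong) (auto simp: dualcoef_def dot_minus algebra_simps)

text \<open>\<open>chi2 (- y)\<close> is a sum of terms that are at most 0, but ellipticity makes it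
  nonnegative, so every term vanishes.\<close>

lemma nef_nonpos:
  assumes "nef y" "y \<le> 0"
  shows "chi2 (- y) = 0" "y a \<noteq> 0 \<Longrightarrow> dualcoef UNIV y a = 0"
proof -
  have le: "y a * dualcoef UNIV y a \<le> 0" for a
    using assms by (auto simp: nef_def le_fun_def mult_le_0_iff)
  have "0 \<le> - y" using assms(2) by (auto simp: le_fun_def)
  then have "0 \<le> chi2 (- y)" by (rule chi2_nonneg)
  moreover have "chi2 (- y) \<le> 0" unfolding chi2_uminus by (rule sum_nonpos) (use le in auto)
  ultimately show z: "chi2 (- y) = 0" by simp
  have "(\<Sum>a\<in>UNIV. - (y a * dualcoef UNIV y a)) = 0" using z by (simp add: chi2_uminus sum_negf)
  then have "- (y a * dualcoef UNIV y a) = 0" for a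
    using le by (subst (asm) sum_nonneg_eq_0_iff) (auto)
  from this[of a] show "y a \<noteq> 0 \<Longrightarrow> dualcoef UNIV y a = 0" by simp
qed

lemma nef_nonpos_C_le:
  assumes "nef y" "y \<le> 0" "y \<noteq> 0"
  shows "C \<le> - y"
  by (rule C_le) (use assms nef_nonpos in \<open>auto simp: le_fun_def\<close>)

text \<open>The minimum with 0 is nef, and by ellipticity its negative dominates \<open>C\<close>;
  on |C| it therefore coincides with \<open>y\<close>, and there \<open>dualcoef\<close> of
  \<open>y\<close> lies between 0 and the vanishing one of \<open>m\<close>.\<close>

lemma min_0_props:
  fixes y :: "'a \<Rightarrow> int"
  assumes "nef y" "\<not> 0 \<le> y"
  defines "m \<equiv> (\<lambda>v. min (y v) (0 v))"
  shows "nef m" "m \<le> 0" "m \<noteq> 0" "C a \<noteq> 0 \<Longrightarrow> m a = y a"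
    "C a \<noteq> 0 \<Longrightarrow> y a < 0" "C a \<noteq> 0 \<Longrightarrow> dualcoef UNIV y a = 0"
proof -
  show n: "nef m" unfolding m_def using assms(1) nef_0 by (rule nef_min)
  show l: "m \<le> 0" by (auto simp: m_def le_fun_def)
  obtain v where "y v < 0" using assms(2) by (auto simp: le_fun_def not_le)
  then have "m v \<noteq> 0" by (simp add: m_def)
  then show nz: "m \<noteq> 0" by auto
  have *: "m a = y a \<and> y a < 0 \<and> dualcoef UNIV y a = 0" if "C a \<noteq> 0"
  proof -
    have "C a \<le> - m a" using nef_nonpos_C_le[OF n l nz] by (auto simp: le_fun_def)
    moreover have "0 < C a" using C_nonneg that by (auto simp: le_fun_def order_less_le)
    ultimately have "m a < 0" by simp
    then have eq: "m a = y a" by (auto simp: m_def min_def split: if_splits)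
    have "dualcoef UNIV y a \<le> dualcoef UNIV m a"
      by (rule dualcoef_mono) (use eq in \<open>auto simp: m_def le_fun_def\<close>)
    also have "\<dots> = 0" using nef_nonpos(2)[OF n l] \<open>m a < 0\<close> by simp
    finally show ?thesis using assms(1) eq \<open>m a < 0\<close> by (auto simp: nef_def order_antisym)
  qed
  then show "C a \<noteq> 0 \<Longrightarrow> m a = y a" "C a \<noteq> 0 \<Longrightarrow> y a < 0" "C a \<noteq> 0 \<Longrightarrow> dualcoef UNIV y a = 0" by auto
qed

section \<open>Antinef cycles and the steps of the elliptic sequence\<close>

definition antinef_cycles :: "'a set \<Rightarrow> ('a \<Rightarrow> int) set" where
  "antinef_cycles B = {d. d \<noteq> 0 \<and> (\<forall>a. d a \<noteq> 0 \<longrightarrow> a \<in> B) \<and> (\<forall>a\<in>B. dot UNIV d a \<le> 0)}"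

context
  fixes c :: "'a \<Rightarrow> int"
  assumes c: "nef c" "c \<le> 0" "c \<noteq> 0"
begin

lemma dot_uminus_nonpos: "c a \<noteq> 0 \<Longrightarrow> dot UNIV (- c) a \<le> 0"
  using nef_nonpos(2)[OF c(1,2), of a] e_le[of a] by (simp add: dot_minus dualcoef_def)

text \<open>On the support of \<open>c\<close> the antinefness of \<open>d\<close> suffices. Off it
  \<open>c + d\<close> vanishes and its neighbours are nonpositive, so it compares favourably with
  the nef vector 0.\<close>

lemma nef_add_antinef:
  assumes "0 \<le> d" "d \<le> - c" "\<And>a. c a \<noteq> 0 \<Longrightarrow> dot UNIV d a \<le> 0"
  shows "nef (c + d)" "c + d \<le> 0"
proof -
  have dc: "0 \<le> d a" "d a \<le> - c a" for a using assms(1,2) by (auto simp: le_fun_def)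
  show le: "c + d \<le> 0"
  proof (rule le_funI)
    show "(c + d) a \<le> 0 a" for a using dc(2)[of a] by simp
  qed
  have "0 \<le> dualcoef UNIV (c + d) a" for a
  proof (cases "c a = 0")
    case True
    then have "(c + d) a = 0 a" using dc[of a] by simp
    then have "dualcoef UNIV 0 a \<le> dualcoef UNIV (c + d) a" using le by (intro dualcoef_mono) auto
    then show ?thesis using dualcoef_0[of a] by simp
  next
    case False
    then show ?thesis using c(1) assms(3)[of a] unfolding dualcoef_add nef_def by (smt (verit))
  qed
  then show "nef (c + d)" by (simp add: nef_def)
qed

text \<open>Truncate \<open>d\<close> at \<open>- c\<close> to \<open>d'\<close>. Then
  \<open>c\<close> and \<open>y = c + d'\<close> are both nef and nonpositive, so
  \<open>chi2\<close> vanishes on their negatives; the mixed term of \<open>- c = - y + d'\<close>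
  is 0 because both have zero \<open>dualcoef\<close> where \<open>y\<close> lives. Hence
  \<open>chi2 d' = 0\<close>.\<close>

lemma C_le_antinef_cycles:
  assumes "d \<in> antinef_cycles {a. c a \<noteq> 0}"
  shows "C \<le> d"
proof -
  have d: "d \<noteq> 0" "\<And>a. d a \<noteq> 0 \<Longrightarrow> c a \<noteq> 0" "\<And>a. c a \<noteq> 0 \<Longrightarrow> dot UNIV d a \<le> 0"
    using assms by (auto simp: antinef_cycles_def)
  have d0: "0 \<le> d"
    by (rule nonneg_of_dot_nonpos) (metis d(2,3) less_irrefl)
  define d' where "d' = (\<lambda>v. min (d v) ((- c) v))"
  have d': "0 \<le> d'" "d' \<le> - c" "d' \<le> d" using d0 c(2) by (auto simp: d'_def le_fun_def)
  have dot': "c a \<noteq> 0 \<Longrightarrow> dot UNIV d' a \<le> 0" for a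
    unfolding d'_def using dot_min_nonpos[of d a "- c"] d(3) dot_uminus_nonpos by blast
  define y where "y = c + d'"
  have y: "nef y" "y \<le> 0" unfolding y_def using nef_add_antinef[OF d'(1,2) dot'] by auto
  obtain a where a: "d a \<noteq> 0" using d(1) by (auto simp: fun_eq_iff)
  then have "c a < 0" "0 < d a" using d(2)[OF a] c(2) d0 by (auto simp: le_fun_def order_less_le)
  then have "d' a \<noteq> 0" by (simp add: d'_def min_def)
  then have "d' \<noteq> 0" by auto
  have "pair (- y) d' = 0" unfolding pair_def
  proof (rule sum.neutral, intro ballI)
    fix a
    show "(- y) a * dot UNIV d' a = 0"
    proof (cases "y a = 0")
      case False
      then have "c a \<noteq> 0"
        using d'(1,2) unfolding y_def le_fun_def by (metis add.right_neutral minus_zero nle_le plus_fun_apply uminus_apply zero_fun_apply)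
      moreover have "dualcoef UNIV y a = dualcoef UNIV c a - dot UNIV d' a" by (simp add: y_def dualcoef_add)
      ultimately show ?thesis using False nef_nonpos(2)[OF y] nef_nonpos(2)[OF c(1,2)] by simp
    qed simp
  qed
  moreover have "- c = - y + d'" by (simp add: y_def)
  then have "chi2 (- c) = chi2 (- y) + chi2 d' - 2 * pair (- y) d'" by (simp only: chi2_add)
  ultimately have "chi2 d' = 0" using nef_nonpos(1) y c by simp
  then have "C \<le> d'" using C_le d'(1) \<open>d' \<noteq> 0\<close> by blast
  then show ?thesis using d'(3) by (rule order_trans)
qed

lemma uminus_in_antinef_cycles: "- c \<in> antinef_cycles {a. c a \<noteq> 0}"
  using c(3) dot_uminus_nonpos by (auto simp: antinef_cycles_def)

text \<open>The common lower bound \<open>C\<close>, positive somewhere, keeps minima of two such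
  cycles from being 0.\<close>

lemma least_antinef_cycles_exists: "\<exists>d\<in>antinef_cycles {a. c a \<noteq> 0}. \<forall>d'\<in>antinef_cycles {a. c a \<noteq> 0}. d \<le> d'"
proof (rule least_of_min_closed[where b = C])
  show "antinef_cycles {a. c a \<noteq> 0} \<noteq> {}" using uminus_in_antinef_cycles by blast
  show "C \<le> x" if "x \<in> antinef_cycles {a. c a \<noteq> 0}" for x using that by (rule C_le_antinef_cycles)
  fix x y assume xy: "x \<in> antinef_cycles {a. c a \<noteq> 0}" "y \<in> antinef_cycles {a. c a \<noteq> 0}"
  let ?m = "\<lambda>v. min (x v) (y v)"
  obtain v where v: "C v \<noteq> 0" using C_nonzero by (auto simp: fun_eq_iff)
  have "C v \<le> x v" "C v \<le> y v" "0 \<le> C v"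
    using xy[THEN C_le_antinef_cycles] C_nonneg by (auto simp: le_fun_def)
  then have "?m v \<noteq> 0" using v by (simp add: min_def)
  then have "?m \<noteq> 0" by (metis zero_fun_apply)
  moreover have "?m a \<noteq> 0 \<longrightarrow> a \<in> {a. c a \<noteq> 0}" for a
    using xy by (auto simp: antinef_cycles_def min_def)
  moreover have "dot UNIV ?m a \<le> 0" if "a \<in> {a. c a \<noteq> 0}" for a
    using xy that by (intro dot_min_nonpos) (auto simp: antinef_cycles_def)
  ultimately show "?m \<in> antinef_cycles {a. c a \<noteq> 0}" by (simp add: antinef_cycles_def)
qed

text \<open>No nef vector is skipped: since \<open>dualcoef\<close> of \<open>c\<close> is 0 on its
  support, \<open>y - c\<close> is itself an antinef cycle there and so dominates the least
  one.\<close>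

lemma next_cycle:
  assumes d: "d \<in> antinef_cycles {a. c a \<noteq> 0}" "\<And>d'. d' \<in> antinef_cycles {a. c a \<noteq> 0} \<Longrightarrow> d \<le> d'"
  shows "nef (c + d)" "c + d \<le> 0"
    and "nef y \<Longrightarrow> y \<le> 0 \<Longrightarrow> c \<le> y \<Longrightarrow> y = c \<or> c + d \<le> y"
proof -
  have "0 \<le> d" using C_nonneg C_le_antinef_cycles[OF d(1)] by (rule order_trans)
  then show "nef (c + d)" "c + d \<le> 0"
    using nef_add_antinef[OF _ d(2)[OF uminus_in_antinef_cycles]] d(1) by (auto simp: antinef_cycles_def)
  assume y: "nef y" "y \<le> 0" "c \<le> y"
  have "y - c \<in> antinef_cycles {a. c a \<noteq> 0}" if "y \<noteq> c"
  proof -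
    have "c a \<noteq> 0" if "(y - c) a \<noteq> 0" for a
    proof
      assume "c a = 0"
      moreover have "c a \<le> y a" "y a \<le> 0" using y by (auto simp: le_fun_def)
      ultimately show False using that by simp
    qed
    moreover have "dot UNIV (y - c) a \<le> 0" if "c a \<noteq> 0" for a
      using nef_nonpos(2)[OF c(1,2) that] y(1) by (simp add: nef_def dualcoef_def dot_diff) (smt (verit))
    ultimately show ?thesis using that by (auto simp: antinef_cycles_def)
  qed
  then show "y = c \<or> c + d \<le> y"
    using d(2)[of "y - c"] by (auto simp: le_fun_def algebra_simps)
qed

end

text \<open>The count is at most 1 because the terms are separated at any vertex of |C|. It is 1 as
  soon as an admissible \<open>y\<close> exists, since the minimum of \<open>y\<close> and 0 agrees
  with \<open>y\<close> on |C| and is a term of the sequence.\<close>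

lemma card_sequence:
  fixes c :: "nat \<Rightarrow> 'a \<Rightarrow> int"
  assumes c0: "nef (c 0)" "\<And>y. nef y \<Longrightarrow> c 0 \<le> y"
    and step: "\<And>n. n < M \<Longrightarrow> \<exists>d\<in>antinef_cycles {a. c n a \<noteq> 0}.
        (\<forall>d'\<in>antinef_cycles {a. c n a \<noteq> 0}. d \<le> d') \<and> c (Suc n) = c n + d"
    and cM: "c M = 0" and nz: "\<And>n. n < M \<Longrightarrow> c n \<noteq> 0"
  shows "card {n. n < M \<and> (\<forall>a. C a \<noteq> 0 \<longrightarrow> c n a = x a)}
    = (if \<exists>y. nef y \<and> \<not> 0 \<le> y \<and> (\<forall>a. C a \<noteq> 0 \<longrightarrow> y a = x a) then 1 else 0)"
proof -
  \<comment> \<open>Every nonpositive nef vector is an earlier term or lies above the current one.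
    At \<open>n = M\<close> the current term is 0, so the sequence lists all nonzero ones.\<close>
  have inv: "nef (c n) \<and> c n \<le> 0 \<and> (\<forall>y. nef y \<longrightarrow> y \<le> 0 \<longrightarrow> (\<exists>i<n. y = c i) \<or> c n \<le> y)"
    if "n \<le> M" for n
    using that
  proof (induction n)
    case 0
    then show ?case using c0 nef_0 by blast
  next
    case (Suc n)
    then have "n < M" by simp
    then have IH: "nef (c n)" "c n \<le> 0" "c n \<noteq> 0" using Suc.IH nz[of n] less_imp_le by blast+
    obtain d where d: "d \<in> antinef_cycles {a. c n a \<noteq> 0}" "\<And>d'. d' \<in> antinef_cycles {a. c n a \<noteq> 0} \<Longrightarrow> d \<le> d'"
      "c (Suc n) = c n + d" using step[of n] Suc.prems by auto
    have "(\<exists>i<Suc n. y = c i) \<or> c n + d \<le> y" if "nef y" "y \<le> 0" for y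
    proof -
      have "(\<exists>i<n. y = c i) \<or> c n \<le> y" using Suc that by (simp only: Suc_leD)
      then show ?thesis using next_cycle(3)[OF IH d(1,2) that] by (auto simp: less_Suc_eq)
    qed
    then show ?case unfolding d(3) using next_cycle(1,2)[OF IH d(1,2)] by blast
  qed
  \<comment> \<open>Each increment is an antinef cycle and so dominates \<open>C\<close>.\<close>
  have incr: "c n a < c (Suc n) a" if "n < M" "C a \<noteq> 0" for n a
  proof -
    have IH: "nef (c n)" "c n \<le> 0" "c n \<noteq> 0" using that nz[of n] inv[of n] less_imp_le by blast+
    obtain d where d: "d \<in> antinef_cycles {a. c n a \<noteq> 0}" "c (Suc n) = c n + d" using step[OF \<open>n < M\<close>] by blast
    have "0 \<le> C a" "C a \<le> d a" using C_le_antinef_cycles[OF IH d(1)] C_nonneg by (auto simp: le_fun_def)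
    then show ?thesis using that d(2) by simp
  qed
  have incr': "c n a < c m a" if "n < m" "m \<le> M" "C a \<noteq> 0" for n m a
    using that
  proof (induction m)
    case (Suc m)
    then have "c m a < c (Suc m) a" by (intro incr) auto
    then show ?case using Suc by (cases "n = m") auto
  qed simp
  obtain s where s: "C s \<noteq> 0" using C_nonzero by (auto simp: fun_eq_iff)
  have uniq: "n = m" if "n < M" "m < M" "c n s = c m s" for n m
    using incr'[of n m s] incr'[of m n s] that s by (cases n m rule: linorder_cases) auto
  show ?thesis
  proof (cases "\<exists>y. nef y \<and> \<not> 0 \<le> y \<and> (\<forall>a. C a \<noteq> 0 \<longrightarrow> y a = x a)")
    case True
    then obtain y where y: "nef y" "\<not> 0 \<le> y" "\<And>a. C a \<noteq> 0 \<Longrightarrow> y a = x a" by blast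
    note m = min_0_props[OF y(1,2)]
    have "\<exists>i<M. (\<lambda>v. min (y v) (0 v)) = c i"
      using inv[of M] m(1,2,3) cM by (metis order_antisym order_refl)
    then obtain i where i: "i < M" "(\<lambda>v. min (y v) (0 v)) = c i" by blast
    have ci: "c i a = x a" if "C a \<noteq> 0" for a
      using m(4)[OF that] y(3)[OF that] i(2) by metis
    have "{n. n < M \<and> (\<forall>a. C a \<noteq> 0 \<longrightarrow> c n a = x a)} = {i}"
      using i(1) ci uniq s by auto
    then show ?thesis using True by simp
  next
    case False
    have "\<not> (\<forall>a. C a \<noteq> 0 \<longrightarrow> c n a = x a)" if "n < M" for n
    proof
      assume "\<forall>a. C a \<noteq> 0 \<longrightarrow> c n a = x a"
      moreover have "nef (c n)" "c n \<le> 0" "c n \<noteq> 0" using that nz[of n] inv[of n] less_imp_le by blast+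
      moreover have "\<not> 0 \<le> c n" using \<open>c n \<le> 0\<close> \<open>c n \<noteq> 0\<close> by (meson order_antisym)
      ultimately show False using False by blast
    qed
    then have "{n. n < M \<and> (\<forall>a. C a \<noteq> 0 \<longrightarrow> c n a = x a)} = {}" by blast
    then show ?thesis using False by (simp only: card.empty if_False)
  qed
qed

text \<open>A cycle in \<open>D\<close> with \<open>\<chi> \<le> 1\<close>, multiplicity one at \<open>v\<close>, and maximal with these properties:
  a positive intersection number with some \<open>E\<^sub>a\<close>, \<open>a \<noteq> v\<close>, would contradict maximality, and with \<open>E\<^sub>v\<close>
  it would make \<open>\<chi>(d + E\<^sub>v + E\<^sub>u) \<le> 0\<close>.\<close>

lemma branch_cycle:
  assumes v: "v \<in> D" and u: "u \<notin> D" "adj u v" and D: "\<And>a. a \<in> D \<Longrightarrow> C a = 0"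
  shows "\<exists>d. d v = 1 \<and> 0 \<le> d \<and> (\<forall>a. a \<notin> D \<longrightarrow> d a = 0) \<and> (\<forall>a\<in>D. dot UNIV d a \<le> 0)"
proof -
  obtain p where p: "\<And>a. dot UNIV p a \<le> -1" "\<And>a. 1 \<le> p a"
    using positive_antinef by blast
  \<comment> \<open>The box \<open>x \<le> p\<close> secures finiteness without obstructing
    maximality: where \<open>d a = p a\<close>, monotonicity gives
    \<open>dot UNIV d a \<le> dot UNIV p a\<close>, a negative number.\<close>
  define X where "X = {x. x v = 1 \<and> 0 \<le> x \<and> x \<le> p \<and> (\<forall>a. a \<notin> D \<longrightarrow> x a = 0) \<and> chi2 x \<le> 2}"
  have "X \<subseteq> Pi\<^sub>E UNIV (\<lambda>w. {0..p w})" by (auto simp: X_def le_fun_def)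
  then have finX: "finite X" by (rule finite_subset) (auto intro: finite_PiE)
  have "0 \<le> p a" for a using p(2)[of a] by simp
  then have "unitv v \<in> X" using v p(2)
    unfolding X_def mem_Collect_eq chi2_unitv
    by (intro conjI le_funI) (auto simp: unitv_def)
  then obtain d where d: "d \<in> X" "\<And>x. x \<in> X \<Longrightarrow> (\<Sum>a\<in>UNIV. x a) \<le> (\<Sum>a\<in>UNIV. d a)"
    using finite_obtain_max[OF finX, of "unitv v" "\<lambda>x. \<Sum>a\<in>UNIV. x a"] by blast
  have dX: "d v = 1" "0 \<le> d" "d \<le> p" "\<And>a. a \<notin> D \<Longrightarrow> d a = 0" "chi2 d \<le> 2"
    using d(1) by (auto simp: X_def)
  have d0: "0 \<le> d a" for a using dX(2) by (auto simp: le_fun_def)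
  have "dot UNIV d a \<le> 0" if a: "a \<in> D" for a
  proof (rule ccontr)
    assume pos: "\<not> dot UNIV d a \<le> 0"
    then have chi: "chi2 (d + unitv a) \<le> 2" using dX(5) by (simp add: chi2_add_unitv)
    show False
    proof (cases "a = v")
      case False
      have "d a \<noteq> p a" using dot_mono[OF dX(3), of a UNIV] p(1)[of a] pos by auto
      then have "d a + 1 \<le> p a" using dX(3) by (auto simp: le_fun_def order_less_le zless_imp_add1_zle)
      then have "d + unitv a \<in> X"
        unfolding X_def using dX a chi False by (auto simp: le_fun_def unitv_def)
      moreover have "(\<Sum>b\<in>UNIV. (d + unitv a) b) = (\<Sum>b\<in>UNIV. d b) + 1"
        by (simp add: sum.distrib unitv_def)
      ultimately show False using d(2)[of "d + unitv a"] by simp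
    next
      case True
      let ?x = "d + unitv a"
      have x0: "0 \<le> ?x b" for b using d0[of b] by (simp add: unitv_def)
      have "?x u = 0" using u v dX(4) True by (auto simp: unitv_def)
      moreover have "?x v \<le> (\<Sum>b | b \<in> UNIV \<and> adj u b. ?x b)"
        by (rule member_le_sum) (use u x0 in auto)
      moreover have "?x v = 2" using dX(1) True by (simp add: unitv_def)
      ultimately have "2 \<le> dot UNIV ?x u" by (simp add: dot_def)
      then have chi': "chi2 (?x + unitv u) \<le> 0" using chi by (simp add: chi2_add_unitv[of ?x])
      have nn: "0 \<le> ?x + unitv u"
      proof (rule le_funI)
        fix b show "0 b \<le> (?x + unitv u) b" using x0[of b] by (simp add: unitv_def)
      qed
      have "(?x + unitv u) v \<noteq> 0" using \<open>?x v = 2\<close> by (simp add: unitv_def)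
      then have "?x + unitv u \<noteq> 0" by (metis zero_fun_apply)
      \<comment> \<open>Off \<open>D\<close> the right-hand side is E_u and on \<open>D\<close> the
        cycle \<open>C\<close> vanishes, so \<open>C\<close> would be E_u, whose \<open>chi2\<close>
        is 2.\<close>
      then have "C \<le> ?x + unitv u" using C_le nn chi' chi2_nonneg[OF nn] by simp
      have "C b \<le> unitv u b" for b
      proof (cases "b \<in> D")
        case True
        then show ?thesis using D[of b] by (simp add: unitv_def)
      next
        case False
        then have "?x b = 0" using dX(4) a by (auto simp: unitv_def)
        moreover have "C b \<le> ?x b + unitv u b"
          using \<open>C \<le> ?x + unitv u\<close> by (simp only: le_fun_def plus_fun_apply)
        ultimately show ?thesis by simp
      qed
      moreover have "0 \<le> C b" for b using C_nonneg by (auto simp: le_fun_def)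
      ultimately have C01: "0 \<le> C b \<and> C b \<le> unitv u b" for b by blast
      have Cb: "C b = 0" if "b \<noteq> u" for b
        using that C01[of b] by (simp add: unitv_def)
      then have "C u \<noteq> 0" using C_nonzero by (metis ext zero_fun_apply)
      then have "C u = 1" using C01[of u] by (simp add: unitv_def)
      then have "C = unitv u" using Cb by (auto simp: unitv_def fun_eq_iff)
      then show False using chi2_C chi2_unitv[of u] by simp
    qed
  qed
  then show ?thesis using dX by blast
qed

end

section \<open>Summation over branches\<close>

text \<open>Iterating \<open>grow\<close> makes \<open>g\<close> unbounded above and below, and the
  superlevel sets of such a nondecreasing function are rays.\<close>

lemma monotone_threshold:
  fixes g :: "int \<Rightarrow> int"
  assumes mono: "\<And>n. g n \<le> g (n + 1)" and grow: "\<And>n. g n + 1 \<le> g (n + c)"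
  shows "\<exists>m. \<forall>n. s \<le> g n \<longleftrightarrow> m \<le> n"
proof -
  have mono': "g n \<le> g n'" if "n \<le> n'" for n n'
    using that
  proof (induction n' rule: int_ge_induct)
    case (step i)
    then show ?case using mono[of i] by simp
  qed simp
  have grow': "g n + int j \<le> g (n + int j * c)" for n j
  proof (induction j)
    case (Suc j)
    then show ?case using grow[of "n + int j * c"] by (simp add: algebra_simps)
  qed simp
  define up where "up = 0 + int (nat (s - g 0)) * c"
  have up: "s \<le> g up"
    using grow'[of 0 "nat (s - g 0)"] unfolding up_def by linarith
  define low where "low = - int (nat (g 0 - s + 1)) * c"
  have "low + int (nat (g 0 - s + 1)) * c = 0" by (simp add: low_def)
  then have low: "g low < s" using grow'[of low "nat (g 0 - s + 1)"] by (simp split: if_splits)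
  define i where "i = (LEAST i. s \<le> g (low + int i))"
  \<comment> \<open>The sign of \<open>c\<close> is unknown; the order of \<open>low\<close> and
    \<open>up\<close> comes from monotonicity.\<close>
  have "low \<le> up" using up low mono'[of up low] by linarith
  then have "s \<le> g (low + int (nat (up - low)))" using up by simp
  then have i: "s \<le> g (low + int i)" unfolding i_def by (rule LeastI)
  have "low + int i \<le> n" if "s \<le> g n" for n
  proof -
    have "low \<le> n" using that low mono'[of n low] by linarith
    then have "i \<le> nat (n - low)" unfolding i_def using that by (intro Least_le) simp
    then show ?thesis using \<open>low \<le> n\<close> by linarith
  qed
  moreover have "s \<le> g n" if "low + int i \<le> n" for n
    using i mono'[OF that] by simp
  ultimately show ?thesis by blast
qed

context elliptic_tree
begin

definition deg :: "'a set \<Rightarrow> 'a \<Rightarrow> nat" where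
  "deg T w = card {b. b \<in> T \<and> adj w b}"

text \<open>By \<open>zcoef_eq\<close> this is z(Z_K + y).\<close>

definition zprod :: "('a \<Rightarrow> int) \<Rightarrow> rat" where
  "zprod y = (\<Prod>w\<in>UNIV. bincoef_ext (int (deg UNIV w) - 2) (dualcoef UNIV y w))"

text \<open>The extension is judged inside the branch only, without the edges leaving it. A lower
  bound \<open>t\<close> at \<open>w\<close> stands in for a maximum whose existence would have to
  be shown first.\<close>

definition liftable :: "('a \<Rightarrow> 'a) \<Rightarrow> 'a \<Rightarrow> int \<Rightarrow> int \<Rightarrow> bool" where
  "liftable \<rho> w n t \<longleftrightarrow> (\<exists>y. y w = n \<and> (\<forall>a. \<rho> a = w \<and> a \<noteq> w \<longrightarrow> 0 \<le> dualcoef {b. \<rho> b = w} y a)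
     \<and> t \<le> dualcoef {b. \<rho> b = w} y w)"

text \<open>\<open>\<rho>\<close> sends each vertex to the vertex of \<open>T\<close> at which its branch is attached, and
  \<open>g w n\<close> is the best value of \<open>dualcoef\<close> at \<open>w\<close> over all extensions of the coefficient \<open>n\<close> at \<open>w\<close>
  to the branch of \<open>w\<close> that are nef off \<open>w\<close>.\<close>

definition branches :: "'a set \<Rightarrow> ('a \<Rightarrow> 'a) \<Rightarrow> ('a \<Rightarrow> int \<Rightarrow> int) \<Rightarrow> bool" where
  "branches T \<rho> g \<longleftrightarrow> (\<forall>a. \<rho> a \<in> T) \<and> (\<forall>a\<in>T. \<rho> a = a)
     \<and> (\<forall>a b. adj a b \<and> \<rho> a \<noteq> \<rho> b \<longrightarrow> a \<in> T \<and> b \<in> T)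
     \<and> (\<forall>w\<in>T. \<forall>n t. t \<le> g w n \<longleftrightarrow> liftable \<rho> w n t)"

text \<open>The product \<open>zprod\<close> read on the tree \<open>T\<close>, where the branch
  optimum \<open>g w n\<close> replaces \<open>- (e w + 2) - e w * n\<close>.\<close>

definition reduced_value :: "'a set \<Rightarrow> ('a \<Rightarrow> int \<Rightarrow> int) \<Rightarrow> ('a \<Rightarrow> int) \<Rightarrow> rat" where
  "reduced_value T g x =
     (\<Prod>w\<in>T. bincoef_ext (int (deg T w) - 2) (g w (x w) - (\<Sum>b | b \<in> T \<and> adj w b. x b)))"

definition fibre :: "'a set \<Rightarrow> ('a \<Rightarrow> int) \<Rightarrow> ('a \<Rightarrow> int) set" where
  "fibre T x = {y. nef y \<and> (\<forall>a\<in>T. y a = x a)}"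

lemma branchesD:
  assumes "branches T \<rho> g"
  shows "\<rho> a \<in> T" "a \<in> T \<Longrightarrow> \<rho> a = a"
    "adj a b \<Longrightarrow> \<rho> a \<noteq> \<rho> b \<Longrightarrow> a \<in> T \<and> b \<in> T"
    "w \<in> T \<Longrightarrow> t \<le> g w n \<longleftrightarrow> liftable \<rho> w n t"
proof -
  note h = assms[unfolded branches_def]
  show "\<rho> a \<in> T" using conjunct1[OF h] by blast
  show "a \<in> T \<Longrightarrow> \<rho> a = a" using conjunct1[OF conjunct2[OF h]] by blast
  show "adj a b \<Longrightarrow> \<rho> a \<noteq> \<rho> b \<Longrightarrow> a \<in> T \<and> b \<in> T"
    using conjunct1[OF conjunct2[OF conjunct2[OF h]]] by blast
  show "w \<in> T \<Longrightarrow> t \<le> g w n \<longleftrightarrow> liftable \<rho> w n t"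
    using conjunct2[OF conjunct2[OF conjunct2[OF h]]] by blast
qed

lemma dot_Un:
  assumes "A \<inter> B = {}"
  shows "dot (A \<union> B) x a = dot A x a + (\<Sum>b | b \<in> B \<and> adj a b. x b)"
proof -
  have "{b. b \<in> A \<union> B \<and> adj a b} = {b. b \<in> A \<and> adj a b} \<union> {b. b \<in> B \<and> adj a b}" by blast
  moreover have "sum x ({b. b \<in> A \<and> adj a b} \<union> {b. b \<in> B \<and> adj a b})
      = sum x {b. b \<in> A \<and> adj a b} + sum x {b. b \<in> B \<and> adj a b}"
    by (rule sum.union_disjoint) (use assms in auto)
  ultimately show ?thesis unfolding dot_def by simp
qed

lemma dualcoef_Un:
  assumes "A \<inter> B = {}"
  shows "dualcoef (A \<union> B) x a = dualcoef A x a - (\<Sum>b | b \<in> B \<and> adj a b. x b)"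
  by (simp add: dualcoef_def dot_Un[OF assms])

text \<open>Add the cycle of \<open>branch_cycle\<close>: it raises the coordinate at
  \<open>v\<close> by one and lowers no \<open>dualcoef\<close> on the branch.\<close>

lemma liftable_Suc:
  assumes "liftable \<rho> v n t" "\<rho> v = v" "adj u v" "\<rho> u \<noteq> v" "\<And>a. \<rho> a = v \<Longrightarrow> C a = 0"
  shows "liftable \<rho> v (n + 1) t"
proof -
  let ?D = "{b. \<rho> b = v}"
  obtain d where d: "d v = 1" "0 \<le> d" "\<And>a. a \<in> ?D \<Longrightarrow> dot UNIV d a \<le> 0"
    using branch_cycle[of v ?D u] assms(2-5) by blast
  have dD: "dot ?D d a \<le> 0" if "a \<in> ?D" for a
    using d(3)[OF that] dot_mono_set[of ?D UNIV d a] d(2) by simp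
  obtain y where y: "y v = n" "\<And>a. \<rho> a = v \<Longrightarrow> a \<noteq> v \<Longrightarrow> 0 \<le> dualcoef ?D y a" "t \<le> dualcoef ?D y v"
    using assms(1) unfolding liftable_def by blast
  have "(y + d) v = n + 1" using y(1) d(1) by simp
  moreover have "0 \<le> dualcoef ?D (y + d) a" if "\<rho> a = v" "a \<noteq> v" for a
    using y(2)[OF that] dD[of a] that by (simp add: dualcoef_add)
  moreover have "t \<le> dualcoef ?D (y + d) v"
    using y(3) dD[of v] assms(2) by (simp add: dualcoef_add)
  ultimately show ?thesis unfolding liftable_def by blast
qed

text \<open>Add the dual vector \<open>p\<close> of \<open>v\<close>, with \<open>c = p v\<close>:
  its negative intersection number at \<open>v\<close> gains at least one there.\<close>

lemma liftable_grow: "\<exists>c. \<forall>n t. liftable \<rho> v n t \<longrightarrow> liftable \<rho> v (n + c) (t + 1)"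
proof -
  obtain p where p: "\<And>w. w \<noteq> v \<Longrightarrow> dot UNIV p w = 0" "dot UNIV p v < 0" "0 \<le> p" "0 < p v"
    using dual_vector[of v] by metis
  let ?D = "{b. \<rho> b = v}"
  have le: "dot ?D p a \<le> dot UNIV p a" for a using dot_mono_set[of ?D UNIV p a] p(3) by simp
  have "liftable \<rho> v (n + p v) (t + 1)" if n: "liftable \<rho> v n t" for n t
  proof -
    obtain y where y: "y v = n" "\<And>a. \<rho> a = v \<Longrightarrow> a \<noteq> v \<Longrightarrow> 0 \<le> dualcoef ?D y a" "t \<le> dualcoef ?D y v"
      using n unfolding liftable_def by blast
    have "(y + p) v = n + p v" using y(1) by simp
    moreover have "0 \<le> dualcoef ?D (y + p) a" if "\<rho> a = v" "a \<noteq> v" for a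
      using y(2)[OF that] le[of a] p(1)[of a] that by (simp add: dualcoef_add)
    moreover have "t + 1 \<le> dualcoef ?D (y + p) v"
      using y(3) le[of v] p(2) by (simp add: dualcoef_add)
    ultimately show ?thesis unfolding liftable_def by blast
  qed
  then show ?thesis by blast
qed

lemma finite_fibre: "T \<noteq> {} \<Longrightarrow> finite (fibre T x)"
proof -
  assume "T \<noteq> {}"
  then obtain u where "u \<in> T" by blast
  then have "fibre T x \<subseteq> {y. nef y \<and> y u \<le> x u}" by (auto simp: fibre_def)
  then show ?thesis using finite_nef by (rule finite_subset)
qed

lemma branches_UNIV: "branches UNIV (\<lambda>a. a) (\<lambda>w n. - (e w + 2) - e w * n)"
proof -
  have "dualcoef {b. b = w} y w = - (e w + 2) - e w * y w" for w y
  proof -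
    have "{b. b \<in> {b. b = w} \<and> adj w b} = {}" using adj_irrefl by auto
    then show ?thesis unfolding dualcoef_def dot_def by (simp only: sum.empty)
  qed
  then have "liftable (\<lambda>a. a) w n t \<longleftrightarrow> t \<le> - (e w + 2) - e w * n" for w n t
    unfolding liftable_def by auto
  then show ?thesis by (simp add: branches_def)
qed

lemma sum_fibre_UNIV: "(\<Sum>y\<in>fibre UNIV x. zprod y) = reduced_value UNIV (\<lambda>w n. - (e w + 2) - e w * n) x"
proof -
  have z: "zprod x = reduced_value UNIV (\<lambda>w n. - (e w + 2) - e w * n) x"
    by (simp add: zprod_def reduced_value_def dualcoef_def dot_def algebra_simps)
  show ?thesis
  proof (cases "nef x")
    case True
    then have "fibre UNIV x = {x}" by (auto simp: fibre_def)
    then show ?thesis using z by simp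
  next
    case False
    then have "fibre UNIV x = {}" by (auto simp: fibre_def fun_eq_iff[symmetric])
    moreover obtain a where "dualcoef UNIV x a < 0" using False by (auto simp: nef_def not_le)
    then have "bincoef_ext (int (deg UNIV a) - 2) (dualcoef UNIV x a) = 0" by simp
    then have "zprod x = 0" unfolding zprod_def by (intro prod_zero) auto
    ultimately show ?thesis using z by simp
  qed
qed

section \<open>Removal of a single leaf\<close>

context
  fixes T v u \<rho> g
  assumes v: "v \<notin> T" and u: "u \<in> T" and uv: "adj u v"
    and unique: "\<And>u'. u' \<in> T \<Longrightarrow> adj u' v \<Longrightarrow> u' = u"
    and br: "branches (insert v T) \<rho> g"
    and CT: "\<And>a. C a \<noteq> 0 \<Longrightarrow> a \<in> T"
begin

text \<open>\<open>m s\<close> is the least coordinate at \<open>v\<close> whose branch optimum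
  reaches \<open>s\<close>. The branch of \<open>v\<close> avoids |C|, which is what
  \<open>liftable_Suc\<close> requires.\<close>

lemma threshold: "\<exists>m. \<forall>s n. s \<le> g v n \<longleftrightarrow> m s \<le> n"
proof -
  have \<rho>: "\<rho> v = v" "\<rho> u = u" "u \<noteq> v" "\<And>a. a \<in> T \<Longrightarrow> \<rho> a = a"
    using branchesD(2)[OF br] u v by auto
  have lift: "t \<le> g v n \<longleftrightarrow> liftable \<rho> v n t" for n t using branchesD(4)[OF br, of v] by blast
  have C0: "C a = 0" if "\<rho> a = v" for a using CT \<rho>(4) that v by metis
  have "g v n \<le> g v (n + 1)" for n
    using liftable_Suc[of \<rho> v n "g v n", OF _ \<rho>(1) uv] \<rho>(2,3) C0 lift by auto
  moreover obtain c where "\<And>n. g v n + 1 \<le> g v (n + c)"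
    using liftable_grow[of \<rho> v] lift by blast
  ultimately have "\<exists>m. \<forall>n. s \<le> g v n \<longleftrightarrow> m \<le> n" for s by (rule monotone_threshold)
  then show ?thesis by (intro choice) auto
qed

text \<open>The branch of \<open>v\<close> joins that of \<open>u\<close>. A coordinate
  \<open>s\<close> at \<open>u\<close> costs \<open>v\<close> the amount \<open>s\<close>, so the
  coordinate at \<open>v\<close> must be at least \<open>m s\<close>; it is subtracted at
  \<open>u\<close>, so \<open>m s\<close> is the best choice and the optimum at \<open>u\<close>
  becomes \<open>g u s - m s\<close>.\<close>

lemma branches_step:
  assumes m: "\<And>s n. s \<le> g v n \<longleftrightarrow> m s \<le> n"
  shows "branches T (\<lambda>a. if \<rho> a = v then u else \<rho> a) (g(u := \<lambda>s. g u s - m s))"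
proof -
  let ?r = "\<lambda>a. if \<rho> a = v then u else \<rho> a"
  let ?g = "g(u := \<lambda>s. g u s - m s)"
  let ?U = "{b. \<rho> b = u}" and ?V = "{b. \<rho> b = v}"
  have \<rho>T: "\<And>a. \<rho> a \<in> insert v T" "\<And>a. a \<in> insert v T \<Longrightarrow> \<rho> a = a"
    and edge: "\<And>a b. adj a b \<Longrightarrow> \<rho> a \<noteq> \<rho> b \<Longrightarrow> a \<in> insert v T \<and> b \<in> insert v T"
    and lift: "\<And>w n t. w \<in> insert v T \<Longrightarrow> t \<le> g w n \<longleftrightarrow> liftable \<rho> w n t"
    using branchesD[OF br] by blast+
  have ne: "u \<noteq> v" using u v by blast
  have \<rho>uv: "\<rho> v = v" "\<rho> u = u" using \<rho>T(2)[of v] \<rho>T(2)[of u] u by blast+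
  have disj: "?U \<inter> ?V = {}" "?V \<inter> ?U = {}" using ne by auto
  have UV: "{b. ?r b = u} = ?U \<union> ?V" by auto
  have no_edge_U: "{b. b \<in> ?V \<and> adj a b} = {}" if "\<rho> a = u" "a \<noteq> u" for a
  proof -
    have "\<rho> b \<noteq> v" if "adj a b" for b
      using edge[OF that] \<rho>T(2)[of a] \<open>\<rho> a = u\<close> \<open>a \<noteq> u\<close> ne by metis
    then show ?thesis by blast
  qed
  have no_edge_V: "{b. b \<in> ?U \<and> adj a b} = {}" if "\<rho> a = v" "a \<noteq> v" for a
  proof -
    have "\<rho> b \<noteq> u" if "adj a b" for b
      using edge[OF that] \<rho>T(2)[of a] \<open>\<rho> a = v\<close> \<open>a \<noteq> v\<close> ne by metis
    then show ?thesis by blast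
  qed
  have edge_u: "{b. b \<in> ?V \<and> adj u b} = {v}"
  proof -
    have "b = v" if "\<rho> b = v" "adj u b" for b
      using edge[OF that(2)] \<rho>T(2)[of b] \<rho>uv that(1) ne by metis
    then show ?thesis using \<rho>uv uv by blast
  qed
  have edge_v: "{b. b \<in> ?U \<and> adj v b} = {u}"
  proof -
    have "b = u" if "\<rho> b = u" "adj v b" for b
      using edge[OF that(2)] \<rho>T(2)[of b] \<rho>uv that(1) ne by metis
    then show ?thesis using \<rho>uv adj_sym[OF uv] by blast
  qed
  have dualcoef_U: "dualcoef {b. ?r b = u} y a = dualcoef ?U y a" if "\<rho> a = u" "a \<noteq> u" for y a
    unfolding UV dualcoef_Un[OF disj(1)] no_edge_U[OF that] by simp
  have dualcoef_V: "dualcoef {b. ?r b = u} y a = dualcoef ?V y a" if "\<rho> a = v" "a \<noteq> v" for y a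
    unfolding UV Un_commute[of ?U] dualcoef_Un[OF disj(2)] no_edge_V[OF that] by simp
  have dualcoef_u: "dualcoef {b. ?r b = u} y u = dualcoef ?U y u - y v" for y
    unfolding UV dualcoef_Un[OF disj(1)] edge_u by simp
  have dualcoef_v: "dualcoef {b. ?r b = u} y v = dualcoef ?V y v - y u" for y
    unfolding UV Un_commute[of ?U] dualcoef_Un[OF disj(2)] edge_v by simp
  have lift_u: "t \<le> g u n - m n \<longleftrightarrow> liftable ?r u n t" for n t
  proof
    assume "t \<le> g u n - m n"
    then have "liftable \<rho> u n (t + m n)" using lift[of u] u by (simp add: algebra_simps)
    then obtain y1 where y1: "y1 u = n" "\<And>a. \<rho> a = u \<Longrightarrow> a \<noteq> u \<Longrightarrow> 0 \<le> dualcoef ?U y1 a" "t + m n \<le> dualcoef ?U y1 u"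
      unfolding liftable_def by blast
    have "liftable \<rho> v (m n) n" using lift[of v] m by auto
    then obtain y2 where y2: "y2 v = m n" "\<And>a. \<rho> a = v \<Longrightarrow> a \<noteq> v \<Longrightarrow> 0 \<le> dualcoef ?V y2 a" "n \<le> dualcoef ?V y2 v"
      unfolding liftable_def by blast
    \<comment> \<open>Glue along the edge from \<open>u\<close> to \<open>v\<close>: the bounds
      \<open>n\<close> at \<open>v\<close> and \<open>t + m n\<close> at \<open>u\<close> absorb
      exactly the losses \<open>y u = n\<close> and \<open>y v = m n\<close>.\<close>
    define y where "y = (\<lambda>a. if \<rho> a = v then y2 a else y1 a)"
    have yU: "dualcoef ?U y a = dualcoef ?U y1 a" if "\<rho> a = u" for a
      by (rule dualcoef_cong) (use that ne in \<open>auto simp: y_def\<close>)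
    have yV: "dualcoef ?V y a = dualcoef ?V y2 a" if "\<rho> a = v" for a
      by (rule dualcoef_cong) (use that ne in \<open>auto simp: y_def\<close>)
    have y: "y u = n" "y v = m n" using \<rho>uv ne y1(1) y2(1) by (auto simp: y_def)
    have "0 \<le> dualcoef {b. ?r b = u} y a" if a: "?r a = u" "a \<noteq> u" for a
    proof (cases "\<rho> a = v")
      case True
      show ?thesis
      proof (cases "a = v")
        case True
        then show ?thesis using dualcoef_v[of y] yV[of v] y y2(3) \<rho>uv by simp
      next
        case False
        then show ?thesis using dualcoef_V[OF True False] yV[OF True] y2(2)[OF True False] by simp
      qed
    next
      case False
      then have "\<rho> a = u" using a by simp
      then show ?thesis using dualcoef_U[OF _ a(2)] yU y1(2)[OF _ a(2)] by simp
    qed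
    moreover have "t \<le> dualcoef {b. ?r b = u} y u" using dualcoef_u[of y] yU[of u] y y1(3) \<rho>uv by simp
    ultimately show "liftable ?r u n t" unfolding liftable_def using y(1) by blast
  next
    assume "liftable ?r u n t"
    then obtain y where y: "y u = n" "\<And>a. ?r a = u \<Longrightarrow> a \<noteq> u \<Longrightarrow> 0 \<le> dualcoef {b. ?r b = u} y a"
      "t \<le> dualcoef {b. ?r b = u} y u"
      unfolding liftable_def by blast
    have "0 \<le> dualcoef ?V y a" if "\<rho> a = v" "a \<noteq> v" for a
    proof -
      have "a \<noteq> u" using that(1) \<rho>uv(2) ne by metis
      then show ?thesis using y(2)[of a] dualcoef_V[OF that] that(1) by simp
    qed
    moreover have "n \<le> dualcoef ?V y v" using y(1) y(2)[of v] dualcoef_v[of y] \<rho>uv ne by simp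
    ultimately have "liftable \<rho> v (y v) n" unfolding liftable_def by blast
    then have le: "m n \<le> y v" using lift[of v] m by auto
    have "0 \<le> dualcoef ?U y a" if "\<rho> a = u" "a \<noteq> u" for a
      using y(2)[of a] dualcoef_U[OF that] that ne by auto
    then have "liftable \<rho> u n (t + y v)"
      unfolding liftable_def using y(1,3) dualcoef_u[of y] by (intro exI[of _ y]) auto
    then have "t + y v \<le> g u n" using lift[of u] u by auto
    then show "t \<le> g u n - m n" using le by simp
  qed
  have lift_w: "t \<le> g w n \<longleftrightarrow> liftable ?r w n t" if "w \<in> T" "w \<noteq> u" for w n t
  proof -
    have "(?r b = w) = (\<rho> b = w)" for b using that v by auto
    then have "liftable ?r w n t = liftable \<rho> w n t" unfolding liftable_def by presburger
    then show ?thesis using lift[of w] that by auto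
  qed
  have "?r a \<in> T" for a using \<rho>T(1)[of a] u by auto
  moreover have "?r a = a" if "a \<in> T" for a using \<rho>T(2)[of a] that v by auto
  moreover have "a \<in> T \<and> b \<in> T" if ab: "adj a b" "?r a \<noteq> ?r b" for a b
  proof -
    have T: "a \<in> insert v T" "b \<in> insert v T" using edge[OF ab(1)] ab(2) by metis+
    have "a \<noteq> v"
    proof
      assume "a = v"
      moreover from this have "b \<noteq> v" using ab(2) by auto
      ultimately have "b = u" using T unique[of b] adj_sym[OF ab(1)] by auto
      then show False using ab(2) \<open>a = v\<close> \<rho>uv ne by auto
    qed
    moreover have "b \<noteq> v"
    proof
      assume "b = v"
      then have "a = u" using T unique[of a] ab(1) \<open>a \<noteq> v\<close> by auto
      then show False using ab(2) \<open>b = v\<close> \<rho>uv ne by auto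
    qed
    ultimately show ?thesis using T by blast
  qed
  moreover have "t \<le> ?g w n \<longleftrightarrow> liftable ?r w n t" if "w \<in> T" for w n t
    using lift_u lift_w that by (cases "w = u") auto
  ultimately show ?thesis unfolding branches_def by blast
qed

text \<open>Slice the fibre by the coordinate \<open>n\<close> at \<open>v\<close>. The leaf factor
  cuts off \<open>n < m (x u)\<close>, only the factor of \<open>u\<close> still depends on
  \<open>n\<close>, and its partial sum lowers the exponent by one, matching the lost edge.\<close>

lemma reduced_value_step:
  assumes m: "\<And>s n. s \<le> g v n \<longleftrightarrow> m s \<le> n"
    and sum: "\<And>x. (\<Sum>y\<in>fibre (insert v T) x. zprod y) = reduced_value (insert v T) g x"
  shows "(\<Sum>y\<in>fibre T x. zprod y) = reduced_value T (g(u := \<lambda>s. g u s - m s)) x"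
proof -
  define K where "K = g u (x u) - (\<Sum>b | b \<in> T \<and> adj u b. x b)"
  \<comment> \<open>\<open>N\<close> must contain every value at \<open>v\<close> in the fibre, for
    the slicing, and the whole window of nonzero terms, for the partial sum.\<close>
  define N where "N = (\<lambda>y. y v) ` fibre T x \<union> {m (x u)..K}"
  define R where "R = (\<Prod>w\<in>T - {u}. bincoef_ext (int (deg T w) - 2) (g w (x w) - (\<Sum>b | b \<in> T \<and> adj w b. x b)))"
  have fin: "finite (fibre T x)" by (rule finite_fibre) (use u in blast)
  then have finN: "finite N" by (simp add: N_def)
  have ne: "u \<noteq> v" using u v by blast
  have nb_v: "{b. b \<in> insert v T \<and> adj v b} = {u}"
    using unique adj_sym[OF uv] u adj_irrefl adj_sym by blast
  have nb_w: "{b. b \<in> insert v T \<and> adj w b} = {b. b \<in> T \<and> adj w b}" if "w \<in> T - {u}" for w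
    using unique that by blast
  have nb_u: "{b. b \<in> insert v T \<and> adj u b} = insert v {b. b \<in> T \<and> adj u b}"
    using uv by blast
  have val: "reduced_value (insert v T) g (x(v := n))
      = (if m (x u) \<le> n then bincoef_ext (int (deg T u) - 1) (K - n) else 0) * R" for n
  proof -
    let ?x = "x(v := n)"
    let ?f = "\<lambda>w. bincoef_ext (int (deg (insert v T) w) - 2) (g w (?x w) - (\<Sum>b | b \<in> insert v T \<and> adj w b. ?x b))"
    have sx: "(\<Sum>b | b \<in> T \<and> adj w b. ?x b) = (\<Sum>b | b \<in> T \<and> adj w b. x b)" for w
      by (rule sum.cong) (use v in auto)
    \<comment> \<open>The leaf has exponent -1, and \<open>g v n - x u \<ge> 0\<close> amounts to
      \<open>m (x u) \<le> n\<close>.\<close>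
    have "?f v = (if m (x u) \<le> n then 1 else 0)"
      unfolding deg_def nb_v using m[of "x u" n] ne by (auto simp: bincoef_ext_minus_one)
    moreover have "?f u = bincoef_ext (int (deg T u) - 1) (K - n)"
    proof -
      have "deg (insert v T) u = Suc (deg T u)" unfolding deg_def nb_u using v by simp
      moreover have "(\<Sum>b | b \<in> insert v T \<and> adj u b. ?x b) = n + (\<Sum>b | b \<in> T \<and> adj u b. x b)"
        unfolding nb_u using v sx[of u] by simp
      ultimately show ?thesis using ne by (simp add: K_def algebra_simps)
    qed
    moreover have "(\<Prod>w\<in>T - {u}. ?f w) = R"
      unfolding R_def
    proof (rule prod.cong[OF refl])
      fix w assume w: "w \<in> T - {u}"
      then have "w \<noteq> v" using v by auto
      then show "?f w = bincoef_ext (int (deg T w) - 2) (g w (x w) - (\<Sum>b | b \<in> T \<and> adj w b. x b))"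
        unfolding deg_def nb_w[OF w] sx by simp
    qed
    moreover have "(\<Prod>w\<in>insert v T. ?f w) = ?f v * (\<Prod>w\<in>T. ?f w)" using v by (intro prod.insert) auto
    moreover have "(\<Prod>w\<in>T. ?f w) = ?f u * (\<Prod>w\<in>T - {u}. ?f w)" using u by (intro prod.remove) auto
    ultimately show ?thesis unfolding reduced_value_def by simp
  qed
  have slice: "{y \<in> fibre T x. y v = n} = fibre (insert v T) (x(v := n))" for n
    using v by (auto simp: fibre_def)
  have "(\<Sum>y\<in>fibre T x. zprod y) = (\<Sum>n\<in>N. \<Sum>y\<in>{y \<in> fibre T x. y v = n}. zprod y)"
    by (rule sum.group[symmetric]) (use fin finN in \<open>auto simp: N_def\<close>)
  also have "\<dots> = (\<Sum>n\<in>N. (if m (x u) \<le> n then bincoef_ext (int (deg T u) - 1) (K - n) else 0) * R)"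
    unfolding slice sum val ..
  also have "\<dots> = (\<Sum>n\<in>N. if m (x u) \<le> n then bincoef_ext (int (deg T u) - 1) (K - n) else 0) * R"
    by (rule sum_distrib_right[symmetric])
  also have "(\<Sum>n\<in>N. if m (x u) \<le> n then bincoef_ext (int (deg T u) - 1) (K - n) else 0)
      = bincoef_ext (int (deg T u) - 1 - 1) (K - m (x u))"
    by (rule bincoef_ext_partial_sum[OF finN]) (auto simp: N_def)
  also have "\<dots> * R = reduced_value T (g(u := \<lambda>s. g u s - m s)) x"
  proof -
    let ?f = "\<lambda>w. bincoef_ext (int (deg T w) - 2) ((g(u := \<lambda>s. g u s - m s)) w (x w) - (\<Sum>b | b \<in> T \<and> adj w b. x b))"
    have "(\<Prod>w\<in>T. ?f w) = ?f u * (\<Prod>w\<in>T - {u}. ?f w)" using u by (intro prod.remove) auto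
    moreover have "(\<Prod>w\<in>T - {u}. ?f w) = R" unfolding R_def by (rule prod.cong) auto
    moreover have "?f u = bincoef_ext (int (deg T u) - 1 - 1) (K - m (x u))"
      by (simp add: K_def algebra_simps)
    ultimately show ?thesis unfolding reduced_value_def by simp
  qed
  finally show ?thesis .
qed

end

text \<open>Induction on the complement of \<open>T\<close>: a vertex \<open>v\<close> adjacent to
  \<open>T\<close> is a leaf of \<open>insert v T\<close> by \<open>unique_neighbour\<close>, so it
  can be summed away.\<close>

lemma reduction:
  assumes "conn T" "\<And>a. C a \<noteq> 0 \<Longrightarrow> a \<in> T"
  shows "\<exists>\<rho> g. branches T \<rho> g \<and> (\<forall>x. (\<Sum>y\<in>fibre T x. zprod y) = reduced_value T g x)"
  using assms
proof (induction "card (UNIV - T)" arbitrary: T)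
  case 0
  then have "T = UNIV" by auto
  then show ?case using branches_UNIV sum_fibre_UNIV by blast
next
  case (Suc n)
  then have "T \<noteq> UNIV" by auto
  moreover have "T \<noteq> {}" using C_nonzero Suc.prems(2) by (auto simp: fun_eq_iff)
  ultimately obtain u v where uv: "u \<in> T" "v \<in> UNIV - T" "adj u v"
    using conn_UNIV unfolding conn_def by blast
  have "UNIV - insert v T = (UNIV - T) - {v}" by auto
  then have "n = card (UNIV - insert v T)" using Suc.hyps(2) uv by simp
  then obtain \<rho> g where g: "branches (insert v T) \<rho> g"
      "\<And>x. (\<Sum>y\<in>fibre (insert v T) x. zprod y) = reduced_value (insert v T) g x"
    using Suc.hyps(1)[of "insert v T"] conn_insert[OF Suc.prems(1) uv(1,3)] Suc.prems(2) by blast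
  have vT: "v \<notin> T" using uv by blast
  have unique: "u' = u" if "u' \<in> T" "adj u' v" for u'
    using unique_neighbour[OF Suc.prems(1) vT] that uv by blast
  obtain m where m: "\<And>s n. s \<le> g v n \<longleftrightarrow> m s \<le> n"
    using threshold[OF vT uv(1,3) unique g(1) Suc.prems(2)] by blast
  show ?case
    by (intro exI conjI allI)
      (rule branches_step[OF vT uv(1,3) unique g(1) Suc.prems(2) m]
        reduced_value_step[OF vT uv(1,3) unique g(1) Suc.prems(2) m g(2)]; assumption)+
qed

text \<open>Over |C| the exponents \<open>?k w\<close> all turn out to be 0: \<open>y0\<close> shows
  them nonnegative, and a nef \<open>y\<close> built from optimal branch extensions has
  \<open>dualcoef\<close> at least \<open>?k w\<close> on |C|, where ellipticity makes it 0. Each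
  factor is then a constant term 1.\<close>

lemma sum_zprod_fibre:
  "(\<Sum>y | nef y \<and> \<not> 0 \<le> y \<and> (\<forall>a. C a \<noteq> 0 \<longrightarrow> y a = x a). zprod y)
    = (if \<exists>y. nef y \<and> \<not> 0 \<le> y \<and> (\<forall>a. C a \<noteq> 0 \<longrightarrow> y a = x a) then 1 else 0)"
proof (cases "\<exists>y. nef y \<and> \<not> 0 \<le> y \<and> (\<forall>a. C a \<noteq> 0 \<longrightarrow> y a = x a)")
  case False
  then show ?thesis by (simp only: if_False) (rule sum.neutral, blast)
next
  case True
  then obtain y0 where y0: "nef y0" "\<not> 0 \<le> y0" "\<And>a. C a \<noteq> 0 \<Longrightarrow> y0 a = x a" by blast
  let ?S = "{a. C a \<noteq> 0}"
  have xneg: "x a < 0" if "C a \<noteq> 0" for a using min_0_props(5)[OF y0(1,2) that] y0(3)[OF that] by simp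
  obtain s where s: "C s \<noteq> 0" using C_nonzero by (auto simp: fun_eq_iff)
  \<comment> \<open>The entries of \<open>x\<close> on |C| are negative, so the prescribed values
    imply \<open>\<not> 0 \<le> y\<close> and the index set is a full fibre.\<close>
  have not_nonneg: "\<not> 0 \<le> y" if "\<And>a. C a \<noteq> 0 \<Longrightarrow> y a = x a" for y
    using xneg[OF s] that[OF s] le_funD[of 0 y s] by auto
  have set: "{y. nef y \<and> \<not> 0 \<le> y \<and> (\<forall>a. C a \<noteq> 0 \<longrightarrow> y a = x a)} = fibre ?S x"
    using not_nonneg by (auto simp: fibre_def)
  obtain \<rho> g where br: "branches ?S \<rho> g" and val: "(\<Sum>y\<in>fibre ?S x. zprod y) = reduced_value ?S g x"
    using reduction[OF conn_support] by blast
  have \<rho>S: "\<And>a. \<rho> a \<in> ?S" "\<And>a. a \<in> ?S \<Longrightarrow> \<rho> a = a"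
    and edge: "\<And>a b. adj a b \<Longrightarrow> \<rho> a \<noteq> \<rho> b \<Longrightarrow> a \<in> ?S \<and> b \<in> ?S"
    and lift: "\<And>w n t. w \<in> ?S \<Longrightarrow> t \<le> g w n \<longleftrightarrow> liftable \<rho> w n t"
    using branchesD[OF br] by blast+
  let ?k = "\<lambda>w. g w (x w) - (\<Sum>b | b \<in> ?S \<and> adj w b. x b)"
  have split: "dualcoef UNIV y a = dualcoef {b. \<rho> b = \<rho> a} y a - (\<Sum>b | b \<in> {b. \<rho> b \<noteq> \<rho> a} \<and> adj a b. y b)" for y a
  proof -
    have "UNIV = {b. \<rho> b = \<rho> a} \<union> {b. \<rho> b \<noteq> \<rho> a}" by auto
    then have "dualcoef UNIV y a = dualcoef ({b. \<rho> b = \<rho> a} \<union> {b. \<rho> b \<noteq> \<rho> a}) y a" by simp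
    also have "\<dots> = dualcoef {b. \<rho> b = \<rho> a} y a - (\<Sum>b | b \<in> {b. \<rho> b \<noteq> \<rho> a} \<and> adj a b. y b)"
      by (rule dualcoef_Un) auto
    finally show ?thesis .
  qed
  have dualcoef_off: "dualcoef UNIV y a = dualcoef {b. \<rho> b = \<rho> a} y a" if "a \<notin> ?S" for y a
  proof -
    have "{b. b \<in> {b. \<rho> b \<noteq> \<rho> a} \<and> adj a b} = {}" using edge[of a] that by force
    then show ?thesis using split[of y a] by (simp only: sum.empty diff_0_right)
  qed
  have dualcoef_on: "dualcoef UNIV y w = dualcoef {b. \<rho> b = w} y w - (\<Sum>b | b \<in> ?S \<and> adj w b. y b)" if "w \<in> ?S" for y w
  proof -
    have "{b. b \<in> {b. \<rho> b \<noteq> \<rho> w} \<and> adj w b} = {b. b \<in> ?S \<and> adj w b}"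
    proof -
      have "b \<in> ?S \<longleftrightarrow> \<rho> b \<noteq> \<rho> w" if "adj w b" for b
        using edge[OF that] \<rho>S(2)[of b] \<rho>S(2)[OF \<open>w \<in> ?S\<close>] adj_irrefl[of w] that by metis
      then show ?thesis by blast
    qed
    then show ?thesis using split[of y w] unfolding \<rho>S(2)[OF that] by simp
  qed
  have sumx: "(\<Sum>b | b \<in> ?S \<and> adj w b. y b) = (\<Sum>b | b \<in> ?S \<and> adj w b. x b)"
    if "\<And>a. C a \<noteq> 0 \<Longrightarrow> y a = x a" for y w
    by (rule sum.cong) (use that in auto)
  have k_nonneg: "0 \<le> ?k w" if w: "w \<in> ?S" for w
  proof -
    have "0 \<le> dualcoef {b. \<rho> b = w} y0 a" if "\<rho> a = w" "a \<noteq> w" for a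
    proof -
      have "a \<notin> ?S" using \<rho>S(2)[of a] that by auto
      then show ?thesis using dualcoef_off[of a y0] y0(1) that(1) unfolding nef_def by metis
    qed
    then have "liftable \<rho> w (x w) (dualcoef {b. \<rho> b = w} y0 w)"
      unfolding liftable_def using y0(3)[of w] w by (intro exI[of _ y0]) auto
    then have "dualcoef {b. \<rho> b = w} y0 w \<le> g w (x w)" using lift[OF w] by blast
    moreover have "0 \<le> dualcoef UNIV y0 w" using y0(1) by (simp add: nef_def)
    ultimately show ?thesis using dualcoef_on[OF w, of y0] sumx[OF y0(3), of w] by linarith
  qed
  have "\<forall>w\<in>?S. \<exists>y. y w = x w \<and> (\<forall>a. \<rho> a = w \<and> a \<noteq> w \<longrightarrow> 0 \<le> dualcoef {b. \<rho> b = w} y a)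
      \<and> g w (x w) \<le> dualcoef {b. \<rho> b = w} y w"
  proof
    fix w assume "w \<in> ?S"
    then have "liftable \<rho> w (x w) (g w (x w))" using lift by blast
    then show "\<exists>y. y w = x w \<and> (\<forall>a. \<rho> a = w \<and> a \<noteq> w \<longrightarrow> 0 \<le> dualcoef {b. \<rho> b = w} y a)
      \<and> g w (x w) \<le> dualcoef {b. \<rho> b = w} y w" unfolding liftable_def .
  qed
  then obtain Y where Y: "\<And>w. w \<in> ?S \<Longrightarrow> Y w w = x w"
      "\<And>w a. w \<in> ?S \<Longrightarrow> \<rho> a = w \<Longrightarrow> a \<noteq> w \<Longrightarrow> 0 \<le> dualcoef {b. \<rho> b = w} (Y w) a"
      "\<And>w. w \<in> ?S \<Longrightarrow> g w (x w) \<le> dualcoef {b. \<rho> b = w} (Y w) w"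
    unfolding bchoice_iff by blast
  \<comment> \<open>On each branch take an extension attaining \<open>g\<close>; branches are joined
    only through edges inside |C|, where all extensions agree with \<open>x\<close>.\<close>
  define y where "y = (\<lambda>a. Y (\<rho> a) a)"
  have yx: "y a = x a" if "C a \<noteq> 0" for a using Y(1)[of a] \<rho>S(2)[of a] that by (simp add: y_def)
  have dualcoef_Y: "dualcoef {b. \<rho> b = \<rho> a} y a = dualcoef {b. \<rho> b = \<rho> a} (Y (\<rho> a)) a" for a
    by (rule dualcoef_cong) (auto simp: y_def)
  have k_le: "?k w \<le> dualcoef UNIV y w" if w: "w \<in> ?S" for w
    using dualcoef_on[OF w, of y] sumx[OF yx, of w] dualcoef_Y[of w] \<rho>S(2)[OF w] Y(3)[OF w] by simp
  have "0 \<le> dualcoef UNIV y a" for a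
  proof (cases "a \<in> ?S")
    case True
    then show ?thesis using k_le k_nonneg order_trans by blast
  next
    case False
    then have "a \<noteq> \<rho> a" using \<rho>S(1)[of a] by auto
    then show ?thesis using dualcoef_off[OF False, of y] dualcoef_Y[of a] Y(2)[OF \<rho>S(1)[of a] refl] by simp
  qed
  then have "nef y" by (simp add: nef_def)
  then have "dualcoef UNIV y w = 0" if "w \<in> ?S" for w
    using min_0_props(6)[OF _ not_nonneg[OF yx]] that by blast
  then have "?k w = 0" if "w \<in> ?S" for w
    using k_nonneg[OF that] k_le[OF that] that by (metis order_antisym)
  then have "reduced_value ?S g x = 1" unfolding reduced_value_def by (intro prod.neutral) simp
  then show ?thesis unfolding set val using True by simp
qed

end

section \<open>Translation to rational cycles\<close>

definition rat_vec :: "('v \<Rightarrow> int) \<Rightarrow> 'v \<Rightarrow> rat" where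
  "rat_vec l = (\<lambda>v. rat_of_int (l v))"

lemma rat_vec_le_iff [simp]: "rat_vec x \<le> rat_vec y \<longleftrightarrow> x \<le> y"
  by (simp add: rat_vec_def le_fun_def)

lemma rat_vec_eq_iff [simp]: "rat_vec x = rat_vec y \<longleftrightarrow> x = y"
  by (simp add: rat_vec_def fun_eq_iff)

lemma rat_vec_0: "rat_vec 0 = 0"
  by (simp add: rat_vec_def fun_eq_iff)

lemma rat_vec_add: "rat_vec (x + y) = rat_vec x + rat_vec y"
  by (simp add: rat_vec_def fun_eq_iff)

lemma supp_rat_vec: "supp (rat_vec x) = {a. x a \<noteq> 0}"
  by (simp add: supp_def rat_vec_def)

lemma inL_iff: "inL x \<longleftrightarrow> (\<exists>l. x = rat_vec l)"
proof
  assume "inL x"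
  then have "\<forall>v. \<exists>k. x v = rat_of_int k" by (auto simp: inL_def elim: Ints_cases)
  then obtain l where "\<And>v. x v = rat_of_int (l v)" by metis
  then show "\<exists>l. x = rat_vec l" by (auto simp: rat_vec_def)
qed (auto simp: inL_def rat_vec_def)

lemma common_denominator:
  fixes x :: "'v::finite \<Rightarrow> rat"
  obtains N p where "0 < N" "\<And>w. rat_of_int N * x w = rat_of_int (p w)"
proof -
  let ?b = "\<lambda>w. snd (quotient_of (x w))"
  let ?N = "\<Prod>w\<in>UNIV. ?b w"
  have b: "0 < ?b w" for w by (rule quotient_of_denom_pos')
  have "rat_of_int ?N * x w = rat_of_int (fst (quotient_of (x w)) * (\<Prod>v\<in>UNIV - {w}. ?b v))" for w
  proof -
    have "x w = rat_of_int (fst (quotient_of (x w))) / rat_of_int (?b w)"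
      by (rule quotient_of_div) simp
    moreover have "?N = ?b w * (\<Prod>v\<in>UNIV - {w}. ?b v)" by (rule prod.remove) auto
    ultimately show ?thesis using b[of w] by (simp add: field_simps)
  qed
  moreover have "0 < ?N" using b by (intro prod_pos) auto
  ultimately show ?thesis by (rule that[rotated])
qed

section \<open>Solving linear equations for the rational form\<close>

context
  fixes e :: "'v::finite \<Rightarrow> int" and adj :: "'v \<Rightarrow> 'v \<Rightarrow> bool"
begin

lemma form_basisE: "form e adj x (basisE w) = (\<Sum>v\<in>UNIV. x v * imat e adj v w)"
proof -
  have "(\<Sum>u\<in>UNIV. x v * basisE w u * imat e adj v u) = x v * imat e adj v w" for v
  proof -
    have "(\<Sum>u\<in>UNIV. x v * basisE w u * imat e adj v u)
        = (\<Sum>u\<in>UNIV. if u = w then x v * imat e adj v u else 0)"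
      by (rule sum.cong) (auto simp: basisE_def)
    then show ?thesis by simp
  qed
  then show ?thesis by (simp add: form_def)
qed

lemma form_expand: "form e adj x y = (\<Sum>w\<in>UNIV. y w * form e adj x (basisE w))"
  unfolding form_basisE form_def[of e adj x y] sum_distrib_left
  by (subst sum.swap) (simp add: mult.assoc mult.left_commute)

lemma form_add_left: "form e adj (x + y) z = form e adj x z + form e adj y z"
  by (simp add: form_def algebra_simps sum.distrib)

lemma form_diff_left: "form e adj (x - y) z = form e adj x z - form e adj y z"
  by (simp add: form_def algebra_simps sum_subtractf)

lemma form_basisE_eqD:
  assumes "neg_definite e adj" "\<And>w. form e adj x (basisE w) = form e adj y (basisE w)"
  shows "x = y"
proof (rule ccontr)
  assume "x \<noteq> y"
  then have "x - y \<noteq> 0" by simp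
  then have "form e adj (x - y) (x - y) < 0" using assms(1) unfolding neg_definite_def by blast
  moreover have "form e adj (x - y) (x - y) = 0"
    unfolding form_expand[of _ "x - y"] by (simp add: form_diff_left assms(2))
  ultimately show False by simp
qed

text \<open>Negative definiteness makes the Gram matrix injective, hence surjective in finite
  dimension. This gives the existence behind the descriptions \<open>ZK\<close> and
  \<open>Estar\<close>.\<close>

lemma form_basisE_surj:
  assumes "neg_definite e adj"
  shows "\<exists>x. \<forall>w. form e adj x (basisE w) = b w"
proof -
  define A :: "rat^'v^'v" where "A = (\<chi> w v. imat e adj v w)"
  have A: "(A *v x) $ w = form e adj (($) x) (basisE w)" for x w
    by (simp add: A_def matrix_vector_mult_def form_basisE mult.commute)
  have "inj ((*v) A)"
  proof (rule injI)
    fix x y assume eq: "A *v x = A *v y"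
    have "($) x = ($) y"
      by (rule form_basisE_eqD[OF assms]) (metis A eq)
    then show "x = y" by (simp add: vec_eq_iff)
  qed
  then have "surj ((*v) A)"
    using matrix_left_invertible_injective matrix_left_right_inverse matrix_right_invertible_surjective
    by blast
  then obtain x where "A *v x = (\<chi> w. b w)" by (metis surjD)
  then have "form e adj (($) x) (basisE w) = b w" for w by (metis A vec_lambda_beta)
  then show ?thesis by blast
qed

lemma form_basisE_ex1:
  assumes "neg_definite e adj"
  shows "\<exists>!x. \<forall>w. form e adj x (basisE w) = b w"
  using form_basisE_surj[OF assms, of b] form_basisE_eqD[OF assms] by (metis (no_types, lifting))

lemma form_ZK:
  assumes "neg_definite e adj"
  shows "form e adj (ZK e adj) (basisE w) = rat_of_int (e w) + 2"
  using theI'[OF form_basisE_ex1[OF assms, of "\<lambda>w. rat_of_int (e w) + 2"]] by (simp add: ZK_def)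

lemma form_Estar:
  assumes "neg_definite e adj"
  shows "form e adj (Estar e adj v) (basisE w) = (if w = v then - 1 else 0)"
  using theI'[OF form_basisE_ex1[OF assms, of "\<lambda>w. if w = v then - 1 else 0"]]
  by (simp add: Estar_def)

end

section \<open>Integer counterparts of the rational notions\<close>

context graph_lattice
begin

lemma form_commute: "form e adj x y = form e adj y x"
proof -
  have "imat e adj v w = imat e adj w v" for v w
    using adj_sym by (auto simp: imat_def)
  then show ?thesis
    unfolding form_def by (subst sum.swap) (simp add: mult.commute)
qed

lemma form_rat_vec_basisE: "form e adj (rat_vec l) (basisE a) = rat_of_int (dot UNIV l a)"
proof -
  have "(\<Sum>v\<in>UNIV. rat_vec l v * imat e adj v a)
      = (\<Sum>v\<in>UNIV. (if v = a then rat_of_int (e a * l a) else 0) + (if adj a v then rat_of_int (l v) else 0))"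
    by (rule sum.cong) (use adj_sym adj_irrefl in \<open>auto simp: rat_vec_def imat_def\<close>)
  also have "\<dots> = rat_of_int (dot UNIV l a)"
    by (simp add: sum.distrib dot_def sum.If_cases)
  finally show ?thesis by (simp add: form_basisE)
qed

lemma form_rat_vec_rat_vec: "form e adj (rat_vec x) (rat_vec x) = rat_of_int (pair x x)"
  unfolding form_expand[of _ _ "rat_vec x" "rat_vec x"] form_rat_vec_basisE pair_def
  by (simp add: rat_vec_def)

context
  assumes neg: "neg_definite e adj"
begin

lemma form_ZK_rat_vec: "form e adj (ZK e adj + rat_vec y) (basisE a) = - rat_of_int (dualcoef UNIV y a)"
  by (simp add: form_add_left form_ZK[OF neg] form_rat_vec_basisE dualcoef_def)

lemma chi_rat_vec: "chi e adj (rat_vec l) = rat_of_int (chi2 l) / 2"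
proof -
  have "form e adj (rat_vec l) (rat_vec l - ZK e adj) = form e adj (rat_vec l - ZK e adj) (rat_vec l)"
    by (rule form_commute)
  also have "\<dots> = (\<Sum>w\<in>UNIV. rat_vec l w * (rat_of_int (dot UNIV l w) - (rat_of_int (e w) + 2)))"
    unfolding form_expand[of _ _ _ "rat_vec l"] form_diff_left form_ZK[OF neg] form_rat_vec_basisE ..
  also have "\<dots> = - rat_of_int (chi2 l)"
    by (simp add: chi2_def rat_vec_def sum_negf[symmetric] algebra_simps)
  finally show ?thesis by (simp add: chi_def)
qed

lemma pair_neg: "x \<noteq> 0 \<Longrightarrow> pair x x < 0"
proof -
  assume "x \<noteq> 0"
  then have "rat_vec x \<noteq> 0" by (metis rat_vec_0 rat_vec_eq_iff)
  then have "form e adj (rat_vec x) (rat_vec x) < 0" using neg unfolding neg_definite_def by blast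
  then show ?thesis by (simp add: form_rat_vec_rat_vec)
qed

text \<open>Clear the denominators of \<open>Estar\<close>.\<close>

lemma integral_dual: "\<exists>p. (\<forall>w. w \<noteq> v \<longrightarrow> dot UNIV p w = 0) \<and> dot UNIV p v < 0"
proof -
  obtain N p where N: "0 < N" "\<And>w. rat_of_int N * Estar e adj v w = rat_of_int (p w)"
    using common_denominator by blast
  have "rat_vec p = (\<lambda>w. rat_of_int N * Estar e adj v w)" using N(2) by (simp add: rat_vec_def)
  then have "rat_of_int (dot UNIV p w) = rat_of_int N * form e adj (Estar e adj v) (basisE w)" for w
    unfolding form_rat_vec_basisE[symmetric] by (simp add: form_basisE sum_distrib_left mult.assoc)
  then have *: "rat_of_int (dot UNIV p w) = rat_of_int (if w = v then - N else 0)" for w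
    by (simp add: form_Estar[OF neg])
  have "dot UNIV p w = (if w = v then - N else 0)" for w using *[of w] by (simp only: of_int_eq_iff)
  then show ?thesis using N(1) by (intro exI[of _ p]) auto
qed

text \<open>The \<open>Estar\<close> vectors are independent, so at most one family of exponents
  contributes, \<open>k a = dualcoef UNIV y a\<close>; a negative value leaves none, and then
  \<open>bincoef_ext\<close> is 0 as well.\<close>

lemma zcoef_eq:
  "zcoef e adj (ZK e adj + rat_vec y) = (\<Prod>v\<in>UNIV. bincoef_ext (int (valency adj v) - 2) (dualcoef UNIV y v))"
proof -
  let ?K = "{k :: 'v \<Rightarrow> nat. (\<lambda>w. \<Sum>v\<in>UNIV. of_nat (k v) * Estar e adj v w) = ZK e adj + rat_vec y}"
  have form_k: "form e adj (\<lambda>w. \<Sum>v\<in>UNIV. of_nat (k v) * Estar e adj v w) (basisE a) = - of_nat (k a)"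
    for k :: "'v \<Rightarrow> nat" and a
  proof -
    have "form e adj (\<lambda>w. \<Sum>v\<in>UNIV. of_nat (k v) * Estar e adj v w) (basisE a)
        = (\<Sum>v\<in>UNIV. of_nat (k v) * form e adj (Estar e adj v) (basisE a))"
      unfolding form_basisE sum_distrib_left sum_distrib_right by (subst sum.swap) (simp add: mult.assoc)
    also have "\<dots> = (\<Sum>v\<in>UNIV. if v = a then - of_nat (k a) else 0)"
      by (rule sum.cong) (auto simp: form_Estar[OF neg])
    finally show ?thesis by simp
  qed
  have K: "k \<in> ?K \<longleftrightarrow> (\<forall>a. int (k a) = dualcoef UNIV y a)" for k
  proof -
    have "k \<in> ?K \<longleftrightarrow> (\<forall>a. - rat_of_nat (k a) = - rat_of_int (dualcoef UNIV y a))"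
    proof
      assume "k \<in> ?K"
      then have "(\<lambda>w. \<Sum>v\<in>UNIV. of_nat (k v) * Estar e adj v w) = ZK e adj + rat_vec y" by blast
      then show "\<forall>a. - rat_of_nat (k a) = - rat_of_int (dualcoef UNIV y a)"
        by (metis form_k form_ZK_rat_vec)
    next
      assume "\<forall>a. - rat_of_nat (k a) = - rat_of_int (dualcoef UNIV y a)"
      then show "k \<in> ?K"
        unfolding mem_Collect_eq
        by (intro form_basisE_eqD[OF neg]) (simp only: form_k form_ZK_rat_vec)
    qed
    also have "\<dots> \<longleftrightarrow> (\<forall>a. int (k a) = dualcoef UNIV y a)"
      by (metis neg_equal_iff_equal of_int_eq_iff of_int_of_nat_eq)
    finally show ?thesis .
  qed
  show ?thesis
  proof (cases "nef y")
    case True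
    then have dualcoef: "0 \<le> dualcoef UNIV y a" for a by (simp add: nef_def)
    have "?K = {\<lambda>a. nat (dualcoef UNIV y a)}"
    proof
      show "?K \<subseteq> {\<lambda>a. nat (dualcoef UNIV y a)}"
      proof
        fix k assume "k \<in> ?K"
        then have "\<forall>a. int (k a) = dualcoef UNIV y a" using K by blast
        then have "k a = nat (dualcoef UNIV y a)" for a by (metis nat_int)
        then show "k \<in> {\<lambda>a. nat (dualcoef UNIV y a)}" by auto
      qed
      show "{\<lambda>a. nat (dualcoef UNIV y a)} \<subseteq> ?K" using K[of "\<lambda>a. nat (dualcoef UNIV y a)"] dualcoef by simp
    qed
    then have "zcoef e adj (ZK e adj + rat_vec y)
        = (\<Prod>v\<in>UNIV. bincoef (int (valency adj v) - 2) (nat (dualcoef UNIV y v)))"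
      unfolding zcoef_def by simp
    moreover have "bincoef_ext p (dualcoef UNIV y v) = bincoef p (nat (dualcoef UNIV y v))" for p v
      using dualcoef[of v] by (simp add: bincoef_ext_def)
    ultimately show ?thesis by simp
  next
    case False
    then obtain a where a: "dualcoef UNIV y a < 0" by (auto simp: nef_def not_le)
    then have "\<not> (\<forall>a. int (k a) = dualcoef UNIV y a)" for k by (metis of_nat_0_le_iff not_less)
    then have "?K = {}" using K by blast
    then have "zcoef e adj (ZK e adj + rat_vec y) = 0" unfolding zcoef_def by (simp only: sum.empty)
    moreover have "bincoef_ext (int (valency adj a) - 2) (dualcoef UNIV y a) = 0" using a by simp
    then have "(\<Prod>v\<in>UNIV. bincoef_ext (int (valency adj v) - 2) (dualcoef UNIV y v)) = 0"
      by (intro prod_zero) auto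
    ultimately show ?thesis by simp
  qed
qed

lemma Sprime_iff: "ZK e adj + rat_vec y \<in> Sprime e adj \<longleftrightarrow> nef y"
  by (simp add: Sprime_def inLprime_def form_ZK_rat_vec nef_def)

lemma sZK_eq:
  assumes "nef s" "\<And>y. nef y \<Longrightarrow> s \<le> y"
  shows "sZK e adj = ZK e adj + rat_vec s"
proof -
  have L: "y \<in> Sprime e adj \<and> inL (y - ZK e adj) \<longleftrightarrow> (\<exists>l. y = ZK e adj + rat_vec l \<and> nef l)" for y
  proof
    assume y: "y \<in> Sprime e adj \<and> inL (y - ZK e adj)"
    then obtain l where "y - ZK e adj = rat_vec l" by (auto simp: inL_iff)
    then have "y = ZK e adj + rat_vec l" by (metis add.commute diff_add_cancel)
    then show "\<exists>l. y = ZK e adj + rat_vec l \<and> nef l" using y Sprime_iff by blast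
  next
    assume "\<exists>l. y = ZK e adj + rat_vec l \<and> nef l"
    then show "y \<in> Sprime e adj \<and> inL (y - ZK e adj)" using Sprime_iff by (auto simp: inL_iff)
  qed
  show ?thesis
    unfolding sZK_def
  proof (rule the_equality)
    show "ZK e adj + rat_vec s \<in> Sprime e adj \<and> inL (ZK e adj + rat_vec s - ZK e adj)
      \<and> (\<forall>y. y \<in> Sprime e adj \<and> inL (y - ZK e adj) \<longrightarrow> ZK e adj + rat_vec s \<le> y)"
    proof (intro conjI allI impI)
      show "ZK e adj + rat_vec s \<in> Sprime e adj" "inL (ZK e adj + rat_vec s - ZK e adj)"
        using L[of "ZK e adj + rat_vec s"] assms(1) by blast+
      fix y assume "y \<in> Sprime e adj \<and> inL (y - ZK e adj)"
      then obtain l where l: "y = ZK e adj + rat_vec l" "nef l" using L by blast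
      then show "ZK e adj + rat_vec s \<le> y" using assms(2)[OF l(2)] by simp
    qed
  next
    fix x assume x: "x \<in> Sprime e adj \<and> inL (x - ZK e adj)
      \<and> (\<forall>y. y \<in> Sprime e adj \<and> inL (y - ZK e adj) \<longrightarrow> x \<le> y)"
    then obtain l where l: "x = ZK e adj + rat_vec l" "nef l" using L by blast
    have "x \<le> ZK e adj + rat_vec s" using x L[of "ZK e adj + rat_vec s"] assms(1) by blast
    moreover have "ZK e adj + rat_vec s \<le> x" using l assms(2)[OF l(2)] by simp
    ultimately show "x = ZK e adj + rat_vec s" by (rule order_antisym)
  qed
qed

end

end

lemma (in elliptic_tree) Zmin_eq:
  assumes "d \<in> antinef_cycles B" "\<And>d'. d' \<in> antinef_cycles B \<Longrightarrow> d \<le> d'"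
  shows "Zmin e adj B = rat_vec d"
proof -
  have "ZminSet e adj B = rat_vec ` antinef_cycles B"
  proof -
    have "rat_vec l \<in> ZminSet e adj B \<longleftrightarrow> l \<in> antinef_cycles B" for l
    proof -
      have "rat_vec l \<noteq> 0 \<longleftrightarrow> l \<noteq> 0" by (metis rat_vec_0 rat_vec_eq_iff)
      then show ?thesis
        by (auto simp: ZminSet_def antinef_cycles_def supp_rat_vec form_rat_vec_basisE inL_iff)
    qed
    moreover have "\<exists>l. x = rat_vec l" if "x \<in> ZminSet e adj B" for x
      using that by (auto simp: ZminSet_def inL_iff)
    ultimately show ?thesis by blast
  qed
  then show ?thesis
    unfolding Zmin_def using assms by (intro the_equality) (auto intro: order_antisym)
qed

lemma elliptic_treeI:
  fixes e :: "'v::finite \<Rightarrow> int"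
  assumes tree: "is_tree adj" and neg: "neg_definite e adj" and ell: "elliptic e adj"
    and C: "min_elliptic_cycle e adj (rat_vec C)"
  shows "elliptic_tree e adj C"
proof -
  interpret graph_lattice e adj
    using tree by unfold_locales (auto simp: is_tree_def)
  have "card {{v, w} | v w. adj v w} = card (UNIV :: 'v set) - 1" "\<And>v w. adj\<^sup>*\<^sup>* v w"
    using tree by (auto simp: is_tree_def)
  moreover have "\<And>v. e v \<le> -2" using ell by (auto simp: elliptic_def)
  moreover note pair_neg[OF neg] integral_dual[OF neg]
  ultimately interpret neg_def_tree e adj by unfold_locales
  have nn: "0 \<le> rat_vec l \<longleftrightarrow> 0 \<le> l" "rat_vec l \<noteq> 0 \<longleftrightarrow> l \<noteq> 0" for l :: "'v \<Rightarrow> int"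
    by (metis rat_vec_0 rat_vec_le_iff) (metis rat_vec_0 rat_vec_eq_iff)
  note C' = C[unfolded min_elliptic_cycle_def nn chi_rat_vec[OF neg]]
  show ?thesis
  proof unfold_locales
    show "0 \<le> chi2 l" if "0 \<le> l" for l
    proof (cases "l = 0")
      case False
      then have "0 \<le> chi e adj (rat_vec l)" using ell that nn unfolding elliptic_def inL_iff by blast
      then show ?thesis by (simp add: chi_rat_vec[OF neg])
    qed simp
    show "0 \<le> C" "C \<noteq> 0" "chi2 C = 0" using C' by auto
    show "0 < chi2 l" if "0 \<le> l" "l \<noteq> 0" "l \<le> C" "l \<noteq> C" for l
    proof -
      have "0 < chi e adj (rat_vec l)"
        using C that nn unfolding min_elliptic_cycle_def inL_iff by (metis rat_vec_eq_iff rat_vec_le_iff)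
      then show ?thesis by (simp add: chi_rat_vec[OF neg])
    qed
  qed
qed

section \<open>Comparison of coefficients with the cycles of the sequence\<close>

theorem mainTheorem4:
  fixes e :: "'v::finite \<Rightarrow> int" and adj :: "'v \<Rightarrow> 'v \<Rightarrow> bool"
    and C :: "'v \<Rightarrow> rat" and M :: nat
  assumes "is_tree adj"
    and "neg_definite e adj"
    and "elliptic e adj"
    and "min_elliptic_cycle e adj C"
    and "Cseq e adj M = ZK e adj"
    and "\<forall>n<M. Cseq e adj n \<noteq> ZK e adj"
  shows "finite (P0_support e adj)
    \<and> (\<forall>a. P0_subst_coeff e adj (supp C) a
           = of_nat (card {n. n < M \<and> restr (supp C) (ZK e adj - EE - Cseq e adj n) = a}))"
proof -
  note neg = assms(2)
  have "inL C" using assms(4) by (simp add: min_elliptic_cycle_def)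
  then obtain D where D: "C = rat_vec D" by (auto simp: inL_iff)
  interpret elliptic_tree e adj D
    by (rule elliptic_treeI) (use assms D in auto)
  let ?S = "supp C"
  have S: "a \<in> ?S \<longleftrightarrow> D a \<noteq> 0" for a by (simp add: D supp_rat_vec)
  obtain s where s: "nef s" "\<And>y. nef y \<Longrightarrow> s \<le> y" using least_nef_exists by blast

  text \<open>Coefficients at \<open>\<ell>\<close> and at \<open>y = - E - \<ell>\<close> are matched by the involution \<open>mirror\<close>.\<close>

  define mirror where "mirror y = (\<lambda>v. - 1 - y v)" for y :: "'v \<Rightarrow> int"
  have ZK_mirror: "ZK e adj - EE - rat_vec (mirror y) = ZK e adj + rat_vec y" for y
    by (auto simp: mirror_def rat_vec_def EE_def)
  have mirror_mirror: "mirror (mirror y) = y" for y by (simp add: mirror_def)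
  have coef: "zcoef e adj (ZK e adj - EE - rat_vec (mirror y)) = zprod y" for y
    unfolding ZK_mirror zcoef_eq[OF neg] by (simp add: zprod_def valency_def deg_def)
  have zprod_nef: "nef y" if "zprod y \<noteq> 0" for y
  proof (rule ccontr)
    assume "\<not> nef y"
    then obtain a where "dualcoef UNIV y a < 0" by (auto simp: nef_def not_le)
    then have "bincoef_ext (int (deg UNIV a) - 2) (dualcoef UNIV y a) = 0" by simp
    then have "zprod y = 0" unfolding zprod_def by (intro prod_zero) auto
    then show False using that by simp
  qed
  have supp_eq: "P0_support e adj = (\<lambda>y. rat_vec (mirror y)) ` {y. \<not> 0 \<le> y \<and> zprod y \<noteq> 0}"
  proof -
    have mem: "rat_vec (mirror y) \<in> P0_support e adj \<longleftrightarrow> \<not> 0 \<le> y \<and> zprod y \<noteq> 0" for y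
    proof -
      have "(\<exists>v. 0 \<le> rat_vec (mirror y) v) \<longleftrightarrow> \<not> 0 \<le> y"
      proof -
        \<comment> \<open>By integrality \<open>- 1 - y v\<close> is nonnegative exactly when
          \<open>y v\<close> is negative.\<close>
        have "0 \<le> rat_vec (mirror y) v \<longleftrightarrow> y v < 0" for v by (simp add: rat_vec_def mirror_def) linarith
        then show ?thesis by (simp add: le_fun_def not_le)
      qed
      then show ?thesis by (simp add: P0_support_def inL_iff coef)
    qed
    have ex: "\<exists>y. x = rat_vec (mirror y)" if "x \<in> P0_support e adj" for x
    proof -
      obtain l where "x = rat_vec l" using \<open>x \<in> P0_support e adj\<close> by (auto simp: P0_support_def inL_iff)
      then have "x = rat_vec (mirror (mirror l))" by (simp only: mirror_mirror)
      then show ?thesis by blast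
    qed
    show ?thesis
    proof (intro set_eqI iffI)
      fix x assume x: "x \<in> P0_support e adj"
      then obtain y where y: "x = rat_vec (mirror y)" using ex by blast
      show "x \<in> (\<lambda>y. rat_vec (mirror y)) ` {y. \<not> 0 \<le> y \<and> zprod y \<noteq> 0}"
        unfolding y using x mem[of y] by (intro imageI) (simp add: y)
    next
      fix x assume "x \<in> (\<lambda>y. rat_vec (mirror y)) ` {y. \<not> 0 \<le> y \<and> zprod y \<noteq> 0}"
      then show "x \<in> P0_support e adj" using mem by (elim imageE) simp
    qed
  qed
  obtain v0 where v0: "D v0 \<noteq> 0" using C_nonzero by (auto simp: fun_eq_iff)
  \<comment> \<open>Such a \<open>y\<close> is negative at every vertex of |C|, and one bounded
    coordinate already leaves finitely many nef vectors.\<close>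
  have fin_nef: "finite {y. nef y \<and> \<not> 0 \<le> y}"
  proof (rule finite_subset[OF _ finite_nef[of v0 0]])
    show "{y. nef y \<and> \<not> 0 \<le> y} \<subseteq> {y. nef y \<and> y v0 \<le> 0}"
      using min_0_props(5)[OF _ _ v0] less_imp_le by blast
  qed
  then have fin: "finite {y. \<not> 0 \<le> y \<and> zprod y \<noteq> 0}"
    by (rule finite_subset[rotated]) (use zprod_nef in blast)

  text \<open>\<open>c n\<close> is \<open>C\<^bsub>n-1\<^esub> - Z\<^sub>K\<close> in the indexing of the paper; \<open>Zmin\<close> is a definite
    description, so it is only evaluated as long as \<open>c n \<noteq> 0\<close>.\<close>

  have Cseq_step: "c \<noteq> 0 \<and> (\<exists>d\<in>antinef_cycles {a. c a \<noteq> 0}. (\<forall>d'\<in>antinef_cycles {a. c a \<noteq> 0}. d \<le> d')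
      \<and> Cseq e adj (Suc n) = ZK e adj + rat_vec (c + d))"
    if n: "n < M" and c: "nef c" "c \<le> 0" "Cseq e adj n = ZK e adj + rat_vec c" for n c
  proof -
    have "Cseq e adj n \<noteq> ZK e adj" using assms(6) n by simp
    then have nz: "c \<noteq> 0" using c(3) rat_vec_0 by (metis add.right_neutral)
    obtain d where d: "d \<in> antinef_cycles {a. c a \<noteq> 0}" "\<And>d'. d' \<in> antinef_cycles {a. c a \<noteq> 0} \<Longrightarrow> d \<le> d'"
      using least_antinef_cycles_exists[OF c(1,2) nz] by blast
    have "supp (ZK e adj - Cseq e adj n) = {a. c a \<noteq> 0}"
      unfolding c(3) by (simp add: supp_def rat_vec_def)
    then have "Cseq e adj (Suc n) = ZK e adj + rat_vec (c + d)"
      unfolding Cseq.simps(2) rat_vec_add using Zmin_eq[OF d] c(3) by (simp only: add.assoc)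
    then show ?thesis using nz d by blast
  qed
  have "\<exists>c. nef c \<and> c \<le> 0 \<and> Cseq e adj n = ZK e adj + rat_vec c" if "n \<le> M" for n
    using that
  proof (induction n)
    case 0
    have "s \<le> 0" using s(2) nef_0 by blast
    then show ?case using s(1) sZK_eq[OF neg s] unfolding Cseq.simps(1) by blast
  next
    case (Suc n)
    then obtain c where c: "nef c" "c \<le> 0" "Cseq e adj n = ZK e adj + rat_vec c"
      by (meson Suc_leD)
    have "n < M" using Suc.prems by simp
    then obtain d where nz: "c \<noteq> 0" and d: "d \<in> antinef_cycles {a. c a \<noteq> 0}"
        "\<And>d'. d' \<in> antinef_cycles {a. c a \<noteq> 0} \<Longrightarrow> d \<le> d'" "Cseq e adj (Suc n) = ZK e adj + rat_vec (c + d)"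
      using Cseq_step[OF _ c] by blast
    then show ?case using next_cycle(1,2)[OF c(1,2) nz d(1,2)] by blast
  qed
  then obtain c where c: "\<And>n. n \<le> M \<Longrightarrow> nef (c n)" "\<And>n. n \<le> M \<Longrightarrow> c n \<le> 0"
      "\<And>n. n \<le> M \<Longrightarrow> Cseq e adj n = ZK e adj + rat_vec (c n)"
    by metis
  have c_step: "\<exists>d\<in>antinef_cycles {a. c n a \<noteq> 0}. (\<forall>d'\<in>antinef_cycles {a. c n a \<noteq> 0}. d \<le> d') \<and> c (Suc n) = c n + d"
    and c_nz: "c n \<noteq> 0" if n: "n < M" for n
  proof -
    have "n \<le> M" "Suc n \<le> M" using n by auto
    note step = Cseq_step[OF n c(1)[OF this(1)] c(2)[OF this(1)] c(3)[OF this(1)],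
        unfolded c(3)[OF this(2)] add_left_cancel rat_vec_eq_iff]
    show "\<exists>d\<in>antinef_cycles {a. c n a \<noteq> 0}. (\<forall>d'\<in>antinef_cycles {a. c n a \<noteq> 0}. d \<le> d') \<and> c (Suc n) = c n + d"
      "c n \<noteq> 0" using step by blast+
  qed
  have c0: "c 0 = s"
    using c(3)[of 0] sZK_eq[OF neg s] by (simp add: fun_eq_iff rat_vec_def)
  have cM: "c M = 0"
    using c(3)[of M] assms(5) by (simp add: fun_eq_iff rat_vec_def)
  have diff: "ZK e adj - EE - Cseq e adj n = rat_vec (mirror (c n))" if "n < M" for n
    using c(3)[of n] that by (auto simp: rat_vec_def mirror_def EE_def)
  have restr_eq: "restr ?S (rat_vec (mirror y)) = restr ?S (rat_vec (mirror x)) \<longleftrightarrow> (\<forall>a. D a \<noteq> 0 \<longrightarrow> y a = x a)" for x y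
    by (auto simp: restr_def S rat_vec_def mirror_def fun_eq_iff)

  have "P0_subst_coeff e adj ?S a
      = of_nat (card {n. n < M \<and> restr ?S (ZK e adj - EE - Cseq e adj n) = a})" for a
  proof (cases "\<exists>x. a = restr ?S (rat_vec (mirror x))")
    \<comment> \<open>Both sides vanish: all exponents that occur are restrictions of integer
      vectors.\<close>
    case False
    then have "{l \<in> P0_support e adj. restr ?S l = a} = {}"
      "{n. n < M \<and> restr ?S (ZK e adj - EE - Cseq e adj n) = a} = {}"
      unfolding supp_eq using diff by auto
    then show ?thesis unfolding P0_subst_coeff_def by (simp only: sum.empty card.empty of_nat_0)
  next
    case True
    then obtain x where x: "a = restr ?S (rat_vec (mirror x))" by blast
    let ?Y = "{y. nef y \<and> \<not> 0 \<le> y \<and> (\<forall>a. D a \<noteq> 0 \<longrightarrow> y a = x a)}"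
    let ?Y' = "{y. (\<not> 0 \<le> y \<and> zprod y \<noteq> 0) \<and> (\<forall>a. D a \<noteq> 0 \<longrightarrow> y a = x a)}"
    have "{l \<in> P0_support e adj. restr ?S l = a} = (\<lambda>y. rat_vec (mirror y)) ` ?Y'"
      unfolding supp_eq x using restr_eq by blast
    moreover have "inj_on (\<lambda>y. rat_vec (mirror y)) ?Y'"
      by (rule inj_onI) (metis rat_vec_eq_iff mirror_mirror)
    ultimately have "P0_subst_coeff e adj ?S a = (\<Sum>y\<in>?Y'. zprod y)"
      unfolding P0_subst_coeff_def by (simp only: sum.reindex o_def coef)
    \<comment> \<open>Nef vectors with coefficient 0 are added, to reach the index set of
      \<open>sum_zprod_fibre\<close>.\<close>
    also have "\<dots> = (\<Sum>y\<in>?Y. zprod y)"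
    proof (rule sum.mono_neutral_left)
      show "finite ?Y" by (rule finite_subset[OF _ fin_nef]) blast
      show "?Y' \<subseteq> ?Y" using zprod_nef by blast
    qed blast
    also have "\<dots> = of_nat (card {n. n < M \<and> (\<forall>a. D a \<noteq> 0 \<longrightarrow> c n a = x a)})"
      unfolding sum_zprod_fibre
      by (subst card_sequence) (use s c_step c_nz cM c0 in auto)
    also have "{n. n < M \<and> (\<forall>a. D a \<noteq> 0 \<longrightarrow> c n a = x a)}
        = {n. n < M \<and> restr ?S (ZK e adj - EE - Cseq e adj n) = a}"
      using diff restr_eq x by auto
    finally show ?thesis .
  qed
  moreover have "finite (P0_support e adj)" unfolding supp_eq using fin by (rule finite_imageI)
  ultimately show ?thesis by blast
qed

end
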